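(* Let $D$ be an integral domain that is not a field, and suppose that $D$ is a $t$-ACC domain. Then (1) $D$ is a UFD if and only if $I_t(D)\vartriangleleft P$ for $P=$ "is a proper nonzero principal ideal"; (2) $D$ is a locally factorial Krull domain if and only if $I_t(D)\vartriangleleft P$ for $P=$ "is a proper invertible ideal".
   Context: Let $K$ be the quotient field of $D$. For a nonzero fractional ideal $I$ of $D$: $I^{-1}=\{x\in K: xI\subseteq D\}$, $I_v=(I^{-1})^{-1}$, and $I_t=\bigcup\{J_v: J\subseteq I \text{ a nonzero finitely generated ideal}\}$. $I$ is a $t$-ideal if $I=I_t$, and $t$-invertible if $(II^{-1})_t=D$. $D$ is a $t$-ACC domain if it satisfies the ascending chain condition on its (integral) $t$-invertible $t$-ideals. $I_t(D)$ is the set of (nonzero) proper integral $t$-ideals of $D$. For a property $P$ of ideals, $I_t(D)\vartriangleleft P$ means that every $s\in I_t(D)$ is contained in some $\gamma\in I_t(D)$ satisfying $P$. $D$ is locally factorial if $D_M$ is a UFD for each maximal ideal $M$. *)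

theory Defs
  imports "HOL.Hull" "HOL-Algebra.Ring_Divisibility" "HOL-Algebra.Ideal_Product" "HOL-Algebra.Subrings"
begin

text \<open>
  Throughout, a domain is given as a subring D of its quotient field K; as a ring in its own
  right it is \<open>K\<lparr>carrier := D\<rparr>\<close>, and integral ideals of D are the library's ideals of that ring.
\<close>

definition quotient_field :: "('a, 'b) ring_scheme \<Rightarrow> 'a set \<Rightarrow> bool" where
  "quotient_field K D \<longleftrightarrow> field K \<and> subring D K \<and>
     carrier K = {a \<otimes>\<^bsub>K\<^esub> inv\<^bsub>K\<^esub> b | a b. a \<in> D \<and> b \<in> D - {\<zero>\<^bsub>K\<^esub>}}"

definition submodule_of_field :: "('a, 'b) ring_scheme \<Rightarrow> 'a set \<Rightarrow> 'a set \<Rightarrow> bool" where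
  "submodule_of_field K D M \<longleftrightarrow>
     additive_subgroup M K \<and> (\<forall>d\<in>D. \<forall>x\<in>M. d \<otimes>\<^bsub>K\<^esub> x \<in> M)"

text \<open>
  A finitely generated D-submodule of K has a common denominator, so it is a fractional ideal
  as soon as it is nonzero; those contained in D are exactly the nonzero finitely generated
  integral ideals.
\<close>

definition fg_fractional_ideal :: "('a, 'b) ring_scheme \<Rightarrow> 'a set \<Rightarrow> 'a set \<Rightarrow> bool" where
  "fg_fractional_ideal K D J \<longleftrightarrow> J \<noteq> {\<zero>\<^bsub>K\<^esub>} \<and>
     (\<exists>S. finite S \<and> S \<subseteq> carrier K \<and> J = submodule_of_field K D hull S)"

definition ideal_inverse :: "('a, 'b) ring_scheme \<Rightarrow> 'a set \<Rightarrow> 'a set \<Rightarrow> 'a set" where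
  "ideal_inverse K D I = {x \<in> carrier K. \<forall>y\<in>I. x \<otimes>\<^bsub>K\<^esub> y \<in> D}"

definition v_closure :: "('a, 'b) ring_scheme \<Rightarrow> 'a set \<Rightarrow> 'a set \<Rightarrow> 'a set" where
  "v_closure K D I = ideal_inverse K D (ideal_inverse K D I)"

definition t_closure :: "('a, 'b) ring_scheme \<Rightarrow> 'a set \<Rightarrow> 'a set \<Rightarrow> 'a set" where
  "t_closure K D I = \<Union> {v_closure K D J | J. J \<subseteq> I \<and> fg_fractional_ideal K D J}"

definition integral_t_ideal :: "('a, 'b) ring_scheme \<Rightarrow> 'a set \<Rightarrow> 'a set \<Rightarrow> bool" where
  "integral_t_ideal K D I \<longleftrightarrow>
     ideal I (K\<lparr>carrier := D\<rparr>) \<and> I \<noteq> {\<zero>\<^bsub>K\<^esub>} \<and> t_closure K D I = I"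

text \<open>
  \<open>ideal_prod K\<close> forms finite sums of products in K, so it is also the product of
  fractional ideals of D.
\<close>

definition t_invertible :: "('a, 'b) ring_scheme \<Rightarrow> 'a set \<Rightarrow> 'a set \<Rightarrow> bool" where
  "t_invertible K D I \<longleftrightarrow> t_closure K D (ideal_prod K I (ideal_inverse K D I)) = D"

definition t_ACC_domain :: "('a, 'b) ring_scheme \<Rightarrow> 'a set \<Rightarrow> bool" where
  "t_ACC_domain K D \<longleftrightarrow>
     (\<forall>I :: nat \<Rightarrow> 'a set.
        (\<forall>n. integral_t_ideal K D (I n) \<and> t_invertible K D (I n)) \<longrightarrow>
        (\<forall>n. I n \<subseteq> I (Suc n)) \<longrightarrow>
        (\<exists>n. \<forall>m\<ge>n. I m = I n))"

definition proper_t_ideals :: "('a, 'b) ring_scheme \<Rightarrow> 'a set \<Rightarrow> 'a set set" where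
  "proper_t_ideals K D = {I. integral_t_ideal K D I \<and> I \<noteq> D}"

definition dominated_by :: "'a set set \<Rightarrow> ('a set \<Rightarrow> bool) \<Rightarrow> bool" (infix \<open>\<lhd>\<^sub>P\<close> 50) where
  "\<Gamma> \<lhd>\<^sub>P P \<longleftrightarrow> (\<forall>s\<in>\<Gamma>. \<exists>\<gamma>\<in>\<Gamma>. s \<subseteq> \<gamma> \<and> P \<gamma>)"

definition proper_nonzero_principal :: "('a, 'b) ring_scheme \<Rightarrow> 'a set \<Rightarrow> 'a set \<Rightarrow> bool" where
  "proper_nonzero_principal K D I \<longleftrightarrow>
     principalideal I (K\<lparr>carrier := D\<rparr>) \<and> I \<noteq> {\<zero>\<^bsub>K\<^esub>} \<and> I \<noteq> D"

definition proper_invertible :: "('a, 'b) ring_scheme \<Rightarrow> 'a set \<Rightarrow> 'a set \<Rightarrow> bool" where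
  "proper_invertible K D I \<longleftrightarrow>
     ideal I (K\<lparr>carrier := D\<rparr>) \<and> I \<noteq> D \<and> ideal_prod K I (ideal_inverse K D I) = D"

text \<open>The localization of D at a prime ideal P, as a subring of K.\<close>

definition localization :: "('a, 'b) ring_scheme \<Rightarrow> 'a set \<Rightarrow> 'a set \<Rightarrow> 'a set" where
  "localization K D P = {a \<otimes>\<^bsub>K\<^esub> inv\<^bsub>K\<^esub> s | a s. a \<in> D \<and> s \<in> D - P}"

definition locally_factorial :: "('a, 'b) ring_scheme \<Rightarrow> 'a set \<Rightarrow> bool" where
  "locally_factorial K D \<longleftrightarrow>
     (\<forall>M. maximalideal M (K\<lparr>carrier := D\<rparr>) \<longrightarrow>
          factorial_domain (K\<lparr>carrier := localization K D M\<rparr>))"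

definition height_one_primes :: "('a, 'b) ring_scheme \<Rightarrow> 'a set \<Rightarrow> 'a set set" where
  "height_one_primes K D =
     {P. primeideal P (K\<lparr>carrier := D\<rparr>) \<and> P \<noteq> {\<zero>\<^bsub>K\<^esub>} \<and>
         (\<forall>Q. primeideal Q (K\<lparr>carrier := D\<rparr>) \<longrightarrow> Q \<noteq> {\<zero>\<^bsub>K\<^esub>} \<longrightarrow> Q \<subseteq> P \<longrightarrow> Q = P)}"

definition discrete_valuation_ring :: "('a, 'b) ring_scheme \<Rightarrow> bool" where
  "discrete_valuation_ring R \<longleftrightarrow>
     principal_domain R \<and> \<not> field R \<and> (\<exists>!M. maximalideal M R)"

text \<open>
  Krull domain: D is the intersection of its localizations at height-one primes, these are
  discrete valuation rings, and each nonzero element lies in only finitely many height-one primes.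
  (For an empty set of height-one primes the intersection is all of K.)
\<close>

definition krull_domain :: "('a, 'b) ring_scheme \<Rightarrow> 'a set \<Rightarrow> bool" where
  "krull_domain K D \<longleftrightarrow>
     D = {x \<in> carrier K. \<forall>P\<in>height_one_primes K D. x \<in> localization K D P} \<and>
     (\<forall>P\<in>height_one_primes K D. discrete_valuation_ring (K\<lparr>carrier := localization K D P\<rparr>)) \<and>
     (\<forall>x\<in>D - {\<zero>\<^bsub>K\<^esub>}. finite {P \<in> height_one_primes K D. x \<in> P})"

end

theory Submission
  imports Defs
begin

text \<open>
  A finite nonzero set \<open>S\<close> inside a \<open>t\<close>-ideal \<open>I\<close> with \<open>S\<^sup>-\<^sup>1 \<subseteq> D\<close> forces \<open>I = D\<close>. In a UFD or a
  Krull domain such an \<open>S\<close> exists in every \<open>t\<close>-ideal that lies in no principal prime, respectively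
  in no height-one prime (take a nonzero \<open>x\<close> and, for each of the finitely many primes over \<open>x\<close>,
  an element avoiding it); if a Krull domain is locally factorial, its height-one primes are
  invertible.

  Conversely, suppose that every proper \<open>t\<close>-ideal lies in a proper invertible ideal. Invertible
  ideals are \<open>t\<close>-invertible \<open>t\<close>-ideals, so by the chain condition every proper \<open>t\<close>-ideal lies in a
  maximal proper invertible ideal, these are prime, and every invertible ideal is a product of
  them. Invertible ideals become principal in \<open>D\<^sub>N\<close> for prime \<open>N\<close>, so each nonzero element of
  \<open>D\<^sub>N\<close> is a product of units and of prime elements generating maximal invertible ideals. Hence
  \<open>D\<^sub>N\<close> is a UFD, and a DVR when \<open>N\<close> itself is maximal invertible; \<open>D\<close> is the intersection of these
  DVRs since \<open>{1, x}\<^sup>-\<^sup>1\<close> is a \<open>t\<close>-ideal. If the dominating ideals are principal, so are the maximal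
  invertible ones, and nonzero elements of \<open>D\<close> itself are products of primes.
\<close>

section \<open>Factorial domains and discrete valuation rings\<close>

text \<open>Having a factorization is encoded as membership in the multiplicative closure of the
  units and \<open>P\<close>. A statement about all nonzero elements can then be proved by rule
  induction, with the cases unit, generator and product, instead of by handling lists of
  factors.\<close>

inductive_set products_of :: "('a, 'b) ring_scheme \<Rightarrow> 'a set \<Rightarrow> 'a set" for R P where
  unit: "u \<in> Units R \<Longrightarrow> u \<in> products_of R P"
| gen: "p \<in> P \<Longrightarrow> p \<in> products_of R P"
| mult: "\<lbrakk>a \<in> products_of R P; b \<in> products_of R P\<rbrakk> \<Longrightarrow> a \<otimes>\<^bsub>R\<^esub> b \<in> products_of R P"

lemma products_of_mono: "P \<subseteq> Q \<Longrightarrow> products_of R P \<subseteq> products_of R Q"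
proof
  fix x assume "P \<subseteq> Q" "x \<in> products_of R P"
  from this(2,1) show "x \<in> products_of R Q"
    by induct (auto intro: products_of.intros)
qed

lemma (in domain) products_of_closed:
  assumes "P \<subseteq> carrier R - {\<zero>}" "x \<in> products_of R P"
  shows "x \<in> carrier R - {\<zero>}"
  using assms(2,1)
proof induct
  case (unit u)
  then show ?case
    by (metis Diff_iff Units_closed Units_r_inv_ex l_null one_not_zero singletonD)
next
  case (mult a b)
  then show ?case by (auto simp: integral_iff)
qed auto

abbreviation prime_elements :: "('a, 'b) ring_scheme \<Rightarrow> 'a set" where
  "prime_elements R \<equiv> {p \<in> carrier R. ring_prime\<^bsub>R\<^esub> p}"

text \<open>An irreducible product has a unit among its two factors, so it is associated to the
  other one; by induction every irreducible element is associated to a prime and hence prime.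
  Factorizations into irreducibles are then unique, and their existence is a second
  induction.\<close>

lemma (in domain) factorial_domainI:
  assumes "carrier R - {\<zero>} \<subseteq> products_of R (prime_elements R)"
  shows "factorial_domain R"
proof -
  let ?P = "prime_elements R"
  have P: "?P \<subseteq> carrier R - {\<zero>}" by (auto simp: ring_prime_def)
  have pr: "prime (mult_of R) a"
    if "a \<in> products_of R ?P" "irreducible (mult_of R) a" for a
    using that
  proof induct
    case (unit u)
    then show ?case by (auto simp: irreducible_def)
  next
    case (gen p)
    then show ?case using ring_primeE(2) by auto
  next
    case (mult a b)
    have ab: "a \<in> carrier R - {\<zero>}" "b \<in> carrier R - {\<zero>}"
      using mult products_of_closed[OF P] by blast+
    have "ring_irreducible (a \<otimes> b)"
      using ab mult by (intro ring_irreducibleI') (auto simp: integral_iff)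
    then consider "a \<in> Units R" | "b \<in> Units R"
      using ring_irreducibleE(5)[of "a \<otimes> b" a b] ab by auto
    then show ?case
    proof cases
      case 1
      have as: "b \<sim>\<^bsub>mult_of R\<^esub> a \<otimes> b"
        using mult_of.associatedI2'[of "a \<otimes> b" b a, THEN mult_of.associated_sym] 1 ab m_comm by auto
      have "irreducible (mult_of R) b"
        using mult.prems as ab mult_of.irreducible_cong[OF _ mult_of.associated_sym[OF as]]
        by (auto simp: integral_iff)
      then show ?thesis
        using mult_of.prime_cong[OF _ as] mult ab by (auto simp: integral_iff)
    next
      case 2
      have as: "a \<sim>\<^bsub>mult_of R\<^esub> a \<otimes> b"
        using mult_of.associatedI2'[of "a \<otimes> b" a b, THEN mult_of.associated_sym] 2 ab by auto
      have "irreducible (mult_of R) a"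
        using mult.prems as ab mult_of.irreducible_cong[OF _ mult_of.associated_sym[OF as]]
        by (auto simp: integral_iff)
      then show ?thesis
        using mult_of.prime_cong[OF _ as] mult ab by (auto simp: integral_iff)
    qed
  qed
  have prm: "primeness_condition_monoid (mult_of R)"
    using pr assms
    by (intro primeness_condition_monoid.intro primeness_condition_monoid_axioms.intro
        mult_of.is_comm_monoid_cancel) auto
  have ex: "\<exists>fs. set fs \<subseteq> carrier (mult_of R) \<and> wfactors (mult_of R) fs a"
    if "a \<in> products_of R ?P" for a
    using that
  proof induct
    case (unit u)
    then have "wfactors (mult_of R) [] u"
      by (intro mult_of.unit_wfactors) auto
    then show ?case by (metis empty_subsetI list.set(1))
  next
    case (gen p)
    then have "prime (mult_of R) p" "p \<in> carrier R - {\<zero>}" using P ring_primeE(2) by auto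
    then have "wfactors (mult_of R) [p] p"
      using mult_of.prime_irreducible[of p] unfolding wfactors_def by auto
    moreover have "set [p] \<subseteq> carrier (mult_of R)" using gen P by auto
    ultimately show ?case by blast
  next
    case (mult a b)
    then obtain fs gs where "set fs \<subseteq> carrier (mult_of R)" "wfactors (mult_of R) fs a"
      "set gs \<subseteq> carrier (mult_of R)" "wfactors (mult_of R) gs b" by blast
    then show ?case
      using mult_of.wfactors_mult[of fs a gs b] mult products_of_closed[OF P]
      by (intro exI[of _ "fs @ gs"]) auto
  qed
  have "factorial_monoid (mult_of R)"
    using ex assms primeness_condition_monoid.wfactors_unique[OF prm]
    by (intro mult_of.factorial_monoidI) auto
  then show ?thesis
    by (simp add: factorial_domain_def domain_axioms)
qed

text \<open>Converse of \<open>factorial_domainI\<close>: irreducible elements of a factorial monoid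
  are prime, so the list of factors of a nonunit multiplies up prime elements.\<close>

lemma (in domain) factorial_monoid_products_of:
  assumes "factorial_monoid (mult_of R)"
  shows "carrier R - {\<zero>} \<subseteq> products_of R (prime_elements R)"
proof
  interpret F: factorial_monoid "mult_of R" by fact
  fix x assume x: "x \<in> carrier R - {\<zero>}"
  have irr: "a \<in> products_of R (prime_elements R)"
    if "irreducible (mult_of R) a" "a \<in> carrier R - {\<zero>}" for a
    using F.irreducible_prime[of a] that ring_primeI'[of a] by (intro products_of.gen) auto
  show "x \<in> products_of R (prime_elements R)"
  proof (cases "x \<in> Units R")
    case True
    then show ?thesis by (rule products_of.unit)
  next
    case False
    then obtain fs where fs: "set fs \<subseteq> carrier (mult_of R)" "factors (mult_of R) fs x"
      using F.factors_exist[of x] x by auto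
    have "\<forall>y\<in>set fs. y \<in> products_of R (prime_elements R)"
      using fs irr by (auto simp: factors_def)
    then have "foldr (\<otimes>) fs \<one> \<in> products_of R (prime_elements R)"
      by (induct fs) (auto intro: products_of.intros)
    then show ?thesis using fs by (simp add: factors_def)
  qed
qed

section \<open>Maximal ideals and discrete valuation rings\<close>

text \<open>Zorn's lemma for the ideals over \<open>I\<close> that avoid \<open>\<one>\<close>;
  avoiding \<open>\<one>\<close> is what survives unions of chains.\<close>

lemma (in ring) exists_maximalideal:
  assumes "ideal I R" "I \<noteq> carrier R"
  shows "\<exists>M. maximalideal M R \<and> I \<subseteq> M"
proof -
  define S where "S = {J. ideal J R \<and> I \<subseteq> J \<and> \<one> \<notin> J}"
  have carr: "\<one> \<in> J \<Longrightarrow> ideal J R \<Longrightarrow> J = carrier R" for J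
    using ideal.one_imp_carrier by blast
  have "I \<in> S" using assms carr by (auto simp: S_def)
  have "\<exists>M\<in>S. \<forall>J\<in>S. M \<subseteq> J \<longrightarrow> J = M"
  proof (rule subset_Zorn)
    fix C assume C: "subset.chain S C"
    show "\<exists>U\<in>S. \<forall>J\<in>C. J \<subseteq> U"
    proof (cases "C = {}")
      case True
      then show ?thesis using \<open>I \<in> S\<close> by auto
    next
      case False
      have "subset.chain {I. ideal I R} C"
        using C unfolding pred_on.chain_def S_def by auto
      then have "ideal (\<Union>C) R" using chain_Union_is_ideal[of C] False by simp
      then have "\<Union>C \<in> S" using C False unfolding pred_on.chain_def S_def by blast
      then show ?thesis by blast
    qed
  qed
  then obtain M where M: "M \<in> S" "\<And>J. J \<in> S \<Longrightarrow> M \<subseteq> J \<Longrightarrow> J = M" by blast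
  have "maximalideal M R"
  proof (rule maximalidealI)
    show "ideal M R" "carrier R \<noteq> M" using M(1) by (auto simp: S_def)
  next
    fix J assume "ideal J R" "M \<subseteq> J" "J \<subseteq> carrier R"
    then show "J = M \<or> J = carrier R"
      using M carr[of J] unfolding S_def by blast
  qed
  then show ?thesis using M(1) by (auto simp: S_def)
qed

text \<open>A nonzero ideal is generated by the least power of \<open>p\<close> that it contains.
  Every nonunit is a multiple of \<open>p\<close>, so \<open>PIdl p\<close> contains every proper
  ideal and is the only maximal ideal.\<close>

lemma (in domain) discrete_valuation_ringI:
  assumes p: "p \<in> carrier R - {\<zero>}" "p \<notin> Units R"
    and fac: "\<And>x. x \<in> carrier R - {\<zero>} \<Longrightarrow> \<exists>u\<in>Units R. \<exists>k::nat. x = u \<otimes> p [^] k"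
  shows "discrete_valuation_ring R"
proof -
  have pc [simp]: "p \<in> carrier R" using p by auto
  have "\<exists>a\<in>carrier R. I = PIdl a" if I: "ideal I R" for I
  proof (cases "I = {\<zero>}")
    case True
    then have "I = PIdl \<zero>" by (auto simp: cgenideal_def intro!: exI[of _ \<zero>])
    then show ?thesis by blast
  next
    case False
    interpret I: ideal I R by fact
    have pow: "p [^] k \<in> I" if "u \<otimes> p [^] k \<in> I" "u \<in> Units R" for u and k :: nat
    proof -
      have "inv u \<otimes> (u \<otimes> p [^] k) \<in> I" using that by (simp add: I.I_l_closed)
      moreover have "inv u \<otimes> (u \<otimes> p [^] k) = p [^] k"
        using that(2) m_assoc[of "inv u" u "p [^] k"] Units_closed by simp
      ultimately show ?thesis by simp
    qed
    obtain x where "x \<in> I" "x \<noteq> \<zero>" using False I.zero_closed by blast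
    then have "\<exists>k::nat. p [^] k \<in> I" using fac[of x] pow I.Icarr by auto
    define k where "k = (LEAST k::nat. p [^] k \<in> I)"
    have k: "p [^] k \<in> I" unfolding k_def by (rule LeastI_ex) fact
    have "I \<subseteq> PIdl (p [^] k)"
    proof
      fix y assume y: "y \<in> I"
      show "y \<in> PIdl (p [^] k)"
      proof (cases "y = \<zero>")
        case True
        then show ?thesis by (auto simp: cgenideal_def intro!: exI[of _ \<zero>])
      next
        case False
        then obtain u and j :: nat where u: "u \<in> Units R" "y = u \<otimes> p [^] j"
          using fac[of y] y I.Icarr by auto
        then have "k \<le> j" unfolding k_def using pow y by (auto intro: Least_le)
        then have "y = (u \<otimes> p [^] (j - k)) \<otimes> p [^] k"
          using u Units_closed by (simp add: m_assoc nat_pow_mult)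
        then show ?thesis using u Units_closed by (auto simp: cgenideal_def)
      qed
    qed
    then have "I = PIdl (p [^] k)" using cgenideal_minimal[OF I k] by blast
    then show ?thesis by auto
  qed
  then have "principal_domain R"
    by (simp add: principal_domain_def principal_domain_axioms_def domain_axioms)
  moreover have "\<not> field R" using field.field_Units p by blast
  moreover have nonunit: "x \<in> PIdl p" if x: "x \<in> carrier R" "x \<notin> Units R" for x
  proof (cases "x = \<zero>")
    case True
    then show ?thesis by (auto simp: cgenideal_def intro!: exI[of _ \<zero>])
  next
    case False
    then obtain u and k :: nat where u: "u \<in> Units R" "x = u \<otimes> p [^] k" using fac[of x] x by auto
    then obtain j where "k = Suc j" using x Units_closed by (cases k) auto
    then have "x = (u \<otimes> p [^] j) \<otimes> p" using u Units_closed by (simp add: m_assoc)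
    then show ?thesis using u Units_closed by (auto simp: cgenideal_def)
  qed
  have unit_carr: "M = carrier R" if "ideal M R" "x \<in> M" "x \<in> Units R" for M x
  proof -
    interpret ideal M R by fact
    have "inv x \<otimes> x \<in> M" using that by (intro I_l_closed[of x "inv x"]) auto
    then show ?thesis using that one_imp_carrier by auto
  qed
  have neq: "carrier R \<noteq> PIdl p" using p ideal_eq_carrier_iff by auto
  have "maximalideal (PIdl p) R"
  proof (rule maximalidealI)
    fix J assume J: "ideal J R" "PIdl p \<subseteq> J" "J \<subseteq> carrier R"
    then show "J = PIdl p \<or> J = carrier R" using nonunit unit_carr by blast
  qed (use neq cgenideal_ideal in auto)
  moreover have "M = PIdl p" if "maximalideal M R" for M
  proof -
    interpret maximalideal M R by fact
    have "M \<subseteq> PIdl p" using nonunit unit_carr is_ideal I_notcarr Icarr by blast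
    moreover have "ideal (PIdl p) R" by (rule cgenideal_ideal) simp
    moreover have "PIdl p \<subseteq> carrier R" by (auto simp: cgenideal_def)
    ultimately show ?thesis using I_maximal[of "PIdl p"] neq by simp
  qed
  ultimately show ?thesis unfolding discrete_valuation_ring_def by blast
qed

text \<open>A nonzero nonunit \<open>s\<close> has an irreducible divisor \<open>b\<close>. Both
  \<open>b\<close> and \<open>p\<close> generate maximal ideals, and there is only one of these, so
  \<open>p\<close> divides \<open>b\<close> and therefore \<open>s\<close>.\<close>

lemma discrete_valuation_ring_prime_divides:
  assumes "discrete_valuation_ring R" "p \<in> carrier R" "ring_prime\<^bsub>R\<^esub> p"
    "s \<in> carrier R" "s \<notin> Units R"
  shows "p divides\<^bsub>R\<^esub> s"
proof -
  interpret principal_domain R using assms by (simp add: discrete_valuation_ring_def)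
  show ?thesis
  proof (cases "s = \<zero>\<^bsub>R\<^esub>")
    case True
    then show ?thesis using assms divides_zero by simp
  next
    case False
    then have "s \<in> carrier R - {\<zero>\<^bsub>R\<^esub>}" using assms by simp
    from exists_irreducible_divisor[OF this assms(5)]
    obtain b where b: "b \<in> carrier R" "ring_irreducible\<^bsub>R\<^esub> b" "b divides\<^bsub>R\<^esub> s" .
    have "maximalideal (PIdl\<^bsub>R\<^esub> b) R" "maximalideal (PIdl\<^bsub>R\<^esub> p) R"
      using irreducible_imp_maximalideal b assms primeness_condition by auto
    then have "PIdl\<^bsub>R\<^esub> b = PIdl\<^bsub>R\<^esub> p" using assms(1) by (auto simp: discrete_valuation_ring_def)
    then have "p divides\<^bsub>R\<^esub> b" using to_contain_is_to_divide[of p b] b assms by auto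
    then show ?thesis using b assms divides_trans by blast
  qed
qed

section \<open>Fractional ideals of a subring of its quotient field\<close>

context field
begin

lemma field_inv:
  assumes "x \<in> carrier R" "x \<noteq> \<zero>"
  shows "inv x \<in> carrier R" "x \<otimes> inv x = \<one>" "inv x \<otimes> x = \<one>" "inv x \<noteq> \<zero>"
proof -
  have x: "x \<in> Units R" using assms field_Units by blast
  then show "inv x \<in> carrier R" "x \<otimes> inv x = \<one>" "inv x \<otimes> x = \<one>" by auto
  then show "inv x \<noteq> \<zero>" using assms by auto
qed

lemma eq_mult_inv_iff:
  assumes "x \<in> carrier R" "y \<in> carrier R" "y \<noteq> \<zero>" "z \<in> carrier R"
  shows "x \<otimes> inv y = z \<longleftrightarrow> x = z \<otimes> y"
proof
  assume "x \<otimes> inv y = z"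
  then show "x = z \<otimes> y" using assms field_inv[of y] by (auto simp: m_assoc)
next
  assume "x = z \<otimes> y"
  then show "x \<otimes> inv y = z" using assms field_inv[of y] by (auto simp: m_assoc)
qed

lemma inv_mult:
  assumes "x \<in> carrier R" "x \<noteq> \<zero>" "y \<in> carrier R" "y \<noteq> \<zero>"
  shows "inv (x \<otimes> y) = inv x \<otimes> inv y"
proof -
  have "(inv x \<otimes> inv y) \<otimes> (x \<otimes> y) = (inv x \<otimes> x) \<otimes> (inv y \<otimes> y)"
    using assms field_inv by (simp add: m_ac)
  then have "(inv x \<otimes> inv y) \<otimes> (x \<otimes> y) = \<one>" using assms field_inv by simp
  then show ?thesis
    using assms field_inv eq_mult_inv_iff[of \<one> "x \<otimes> y" "inv x \<otimes> inv y"]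
    by (auto simp: integral_iff)
qed

lemma subring_Units_iff:
  assumes S: "subring S R"
  shows "u \<in> Units (R\<lparr>carrier := S\<rparr>) \<longleftrightarrow> u \<in> S \<and> u \<noteq> \<zero> \<and> inv u \<in> S"
proof
  assume "u \<in> Units (R\<lparr>carrier := S\<rparr>)"
  then obtain v where v: "u \<in> S" "v \<in> S" "u \<otimes> v = \<one>" "v \<otimes> u = \<one>"
    unfolding Units_def by auto
  then have c: "u \<in> carrier R" "v \<in> carrier R" using subringE(1)[OF S] by auto
  then have "u \<noteq> \<zero>" using v by auto
  then have "inv u = v" using v c inv_unique' by auto
  then show "u \<in> S \<and> u \<noteq> \<zero> \<and> inv u \<in> S" using v \<open>u \<noteq> \<zero>\<close> by auto
next
  assume "u \<in> S \<and> u \<noteq> \<zero> \<and> inv u \<in> S"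
  moreover from this have "u \<in> carrier R" using subringE(1)[OF S] by auto
  ultimately show "u \<in> Units (R\<lparr>carrier := S\<rparr>)"
    using field_inv[of u] unfolding Units_def by auto
qed

lemma subring_divides_iff:
  assumes S: "subring S R" and "a \<in> S" "a \<noteq> \<zero>" "b \<in> S"
  shows "a divides\<^bsub>R\<lparr>carrier := S\<rparr>\<^esub> b \<longleftrightarrow> b \<otimes> inv a \<in> S"
proof -
  have c: "S \<subseteq> carrier R" using subringE(1)[OF S] .
  have ab: "a \<in> carrier R" "b \<in> carrier R" using assms c by auto
  have "b = a \<otimes> (b \<otimes> inv a)"
    using ab assms(3) field_inv[of a] m_lcomm[of a b "inv a"] by simp
  moreover have "b \<otimes> inv a = d" if "d \<in> S" "b = a \<otimes> d" for d
    using eq_mult_inv_iff[of b a d] that ab assms(3) c m_comm[of a d] by blast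
  ultimately have "(\<exists>d\<in>S. b = a \<otimes> d) \<longleftrightarrow> b \<otimes> inv a \<in> S" by metis
  then show ?thesis unfolding factor_def by simp
qed

text \<open>Divisibility by \<open>p\<close> becomes membership of a quotient in \<open>S\<close>.
  Primality in \<open>D\<close> and in its various localizations can thus be compared inside one
  field.\<close>

lemma subring_ring_prime_iff:
  assumes S: "subring S R" and p: "p \<in> S"
  shows "ring_prime\<^bsub>R\<lparr>carrier := S\<rparr>\<^esub> p \<longleftrightarrow> p \<noteq> \<zero> \<and> inv p \<notin> S \<and>
    (\<forall>a\<in>S. \<forall>b\<in>S. a \<otimes> b \<otimes> inv p \<in> S \<longrightarrow> a \<otimes> inv p \<in> S \<or> b \<otimes> inv p \<in> S)"
proof (cases "p = \<zero>")
  case False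
  then show ?thesis
    using subring_divides_iff[OF S p False] subring_Units_iff[OF S, of p] subringE(6)[OF S] p
    unfolding ring_prime_def prime_def by simp
qed (simp add: ring_prime_def)

end

locale fraction_field = field K for K :: "('a, 'b) ring_scheme" (structure) +
  fixes D :: "'a set"
  assumes D_subring: "subring D K"
    and fraction: "x \<in> carrier K \<Longrightarrow> \<exists>a\<in>D. \<exists>b\<in>D - {\<zero>}. x = a \<otimes> inv b"
begin

abbreviation DD where "DD \<equiv> K\<lparr>carrier := D\<rparr>"
abbreviation Inv where "Inv \<equiv> ideal_inverse K D"
abbreviation submod where "submod \<equiv> submodule_of_field K D"
abbreviation loc where "loc \<equiv> localization K D"

section \<open>Submodules of the field and ideals of \<open>D\<close>\<close>

lemma D_closed [simp, intro]:
  shows "x \<in> D \<Longrightarrow> x \<in> carrier K" "\<zero> \<in> D" "\<one> \<in> D"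
    "\<lbrakk>x \<in> D; y \<in> D\<rbrakk> \<Longrightarrow> x \<oplus> y \<in> D" "\<lbrakk>x \<in> D; y \<in> D\<rbrakk> \<Longrightarrow> x \<otimes> y \<in> D" "x \<in> D \<Longrightarrow> \<ominus> x \<in> D"
  using subringE[OF D_subring] by auto

lemma DD_domain: "domain DD"
  by (rule subring_is_domain[OF D_subring])

lemma submod_iff:
  "submod M \<longleftrightarrow> M \<subseteq> carrier K \<and> \<zero> \<in> M \<and> (\<forall>x\<in>M. \<forall>y\<in>M. x \<oplus> y \<in> M) \<and> (\<forall>d\<in>D. \<forall>x\<in>M. d \<otimes> x \<in> M)"
  (is "_ \<longleftrightarrow> ?r")
proof
  assume "submod M"
  then have "additive_subgroup M K" "\<forall>d\<in>D. \<forall>x\<in>M. d \<otimes> x \<in> M"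
    unfolding submodule_of_field_def by auto
  then show ?r
    using additive_subgroup.a_subset additive_subgroup.zero_closed additive_subgroup.a_closed
    by metis
next
  assume r: ?r
  \<comment> \<open>Additive inverses come for free, by scaling with
    \<open>\<ominus> \<one> \<in> D\<close>.\<close>
  have "\<ominus> x \<in> M" if "x \<in> M" for x
  proof -
    have "(\<ominus> \<one>) \<otimes> x \<in> M" using r that by auto
    moreover have "x \<in> carrier K" using r that by auto
    ultimately show ?thesis using l_minus[of \<one> x] by auto
  qed
  then have "subgroup M (add_monoid K)"
    using r by (intro subgroup.intro) (auto simp: a_inv_def)
  then show "submod M" using r unfolding submodule_of_field_def additive_subgroup_def by auto
qed

lemma submodD:
  assumes "submod M"
  shows "x \<in> M \<Longrightarrow> x \<in> carrier K" "\<zero> \<in> M" "\<lbrakk>x \<in> M; y \<in> M\<rbrakk> \<Longrightarrow> x \<oplus> y \<in> M"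
    "\<lbrakk>d \<in> D; x \<in> M\<rbrakk> \<Longrightarrow> d \<otimes> x \<in> M" "\<lbrakk>d \<in> D; x \<in> M\<rbrakk> \<Longrightarrow> x \<otimes> d \<in> M"
proof -
  show "x \<in> M \<Longrightarrow> x \<in> carrier K" "\<zero> \<in> M" "\<lbrakk>x \<in> M; y \<in> M\<rbrakk> \<Longrightarrow> x \<oplus> y \<in> M"
    and *: "\<lbrakk>d \<in> D; x \<in> M\<rbrakk> \<Longrightarrow> d \<otimes> x \<in> M"
    using assms unfolding submod_iff by auto
  show "\<lbrakk>d \<in> D; x \<in> M\<rbrakk> \<Longrightarrow> x \<otimes> d \<in> M"
    using * assms m_comm[of x d] unfolding submod_iff by auto
qed

text \<open>Integral ideals become submodules of the field, the notion that also covers their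
  inverses and products.\<close>

lemma ideal_iff: "ideal I DD \<longleftrightarrow> I \<subseteq> D \<and> submod I"
proof
  assume "ideal I DD"
  then interpret I: ideal I DD .
  show "I \<subseteq> D \<and> submod I"
    unfolding submod_iff
    using I.a_subset additive_subgroup.zero_closed[OF I.is_additive_subgroup]
      additive_subgroup.a_closed[OF I.is_additive_subgroup] I.I_l_closed by auto
next
  assume r: "I \<subseteq> D \<and> submod I"
  have "subgroup I (add_monoid K)" "subgroup D (add_monoid K)"
    using r D_subring
    unfolding submodule_of_field_def additive_subgroup_def subring_def by auto
  then have "subgroup I ((add_monoid K)\<lparr>carrier := D\<rparr>)"
    using r add.subgroup_incl by blast
  then have "subgroup I (add_monoid DD)" by simp
  then show "ideal I DD"
    using r subring_is_ring[OF D_subring] submodD[of I]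
    by (intro idealI) auto
qed

lemma primeideal_iff:
  "primeideal P DD \<longleftrightarrow> P \<subseteq> D \<and> submod P \<and> \<one> \<notin> P \<and> (\<forall>a\<in>D. \<forall>b\<in>D. a \<otimes> b \<in> P \<longrightarrow> a \<in> P \<or> b \<in> P)"
proof
  assume "primeideal P DD"
  then interpret P: primeideal P DD .
  have "\<one> \<notin> P" using P.I_notcarr P.one_imp_carrier by auto
  then show "P \<subseteq> D \<and> submod P \<and> \<one> \<notin> P \<and> (\<forall>a\<in>D. \<forall>b\<in>D. a \<otimes> b \<in> P \<longrightarrow> a \<in> P \<or> b \<in> P)"
    using P.is_ideal ideal_iff P.I_prime by auto
next
  assume "P \<subseteq> D \<and> submod P \<and> \<one> \<notin> P \<and> (\<forall>a\<in>D. \<forall>b\<in>D. a \<otimes> b \<in> P \<longrightarrow> a \<in> P \<or> b \<in> P)"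
  moreover from this have "ideal P DD" "D \<noteq> P" using ideal_iff by auto
  ultimately show "primeideal P DD"
    using DD_domain[THEN domain.axioms(1)] by (intro primeidealI) auto
qed

lemma primeD:
  assumes "primeideal P DD"
  shows "P \<subseteq> D" "submod P" "\<one> \<notin> P" "\<zero> \<in> P" "\<lbrakk>a \<in> D; b \<in> D; a \<otimes> b \<in> P\<rbrakk> \<Longrightarrow> a \<in> P \<or> b \<in> P"
  using assms submodD(2) unfolding primeideal_iff by auto

lemma maximalideal_primeideal: "maximalideal M DD \<Longrightarrow> primeideal M DD"
  using cring.maximalideal_prime[OF domain.axioms(1)[OF DD_domain]] .

lemma principalideal_iff: "principalideal I DD \<longleftrightarrow> (\<exists>a\<in>D. I = (\<lambda>d. d \<otimes> a) ` D)"
proof -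
  interpret R: domain DD by (rule DD_domain)
  have eq: "Idl\<^bsub>DD\<^esub> {a} = (\<lambda>d. d \<otimes> a) ` D" if "a \<in> D" for a
    using R.cgenideal_eq_genideal[of a] that by (auto simp: cgenideal_def)
  show ?thesis
  proof
    assume "principalideal I DD"
    then show "\<exists>a\<in>D. I = (\<lambda>d. d \<otimes> a) ` D"
      using principalideal.generate[of I DD] eq by auto
  next
    assume "\<exists>a\<in>D. I = (\<lambda>d. d \<otimes> a) ` D"
    then obtain a where a: "a \<in> D" "I = Idl\<^bsub>DD\<^esub> {a}" using eq by auto
    then have "ideal I DD" using R.genideal_ideal[of "{a}"] by simp
    then show "principalideal I DD"
      using a by (intro principalideal.intro principalideal_axioms.intro) auto
  qed
qed

section \<open>Inverses, divisorial ideals and t-ideals\<close>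

lemma Inv_iff: "x \<in> Inv I \<longleftrightarrow> x \<in> carrier K \<and> (\<forall>y\<in>I. x \<otimes> y \<in> D)"
  by (simp add: ideal_inverse_def)

lemma Inv_antimono: "I \<subseteq> J \<Longrightarrow> Inv J \<subseteq> Inv I"
  unfolding Inv_iff subset_iff by blast

lemma Inv_submod:
  assumes "I \<subseteq> carrier K"
  shows "submod (Inv I)"
  unfolding submod_iff
proof (intro conjI ballI)
  show "Inv I \<subseteq> carrier K" by (auto simp: Inv_iff)
  show "\<zero> \<in> Inv I" using assms by (auto simp: Inv_iff)
next
  fix x y assume "x \<in> Inv I" "y \<in> Inv I"
  then show "x \<oplus> y \<in> Inv I" using assms l_distr by (auto simp: Inv_iff subset_iff)
next
  fix d x assume "d \<in> D" "x \<in> Inv I"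
  then show "d \<otimes> x \<in> Inv I" using assms m_assoc by (auto simp: Inv_iff subset_iff)
qed

lemma Inv_carrier [simp]: "Inv I \<subseteq> carrier K"
  by (auto simp: Inv_iff)

lemma subset_v:
  assumes "I \<subseteq> carrier K"
  shows "I \<subseteq> Inv (Inv I)"
proof
  fix x assume x: "x \<in> I"
  have "x \<otimes> y \<in> D" if "y \<in> Inv I" for y
    using that x assms m_comm[of x y] unfolding Inv_iff by auto
  then show "x \<in> Inv (Inv I)" using x assms unfolding Inv_iff[of _ "Inv I"] by blast
qed

text \<open>The double inverse of \<open>S\<close> is a submodule containing \<open>S\<close>, hence
  contains the hull; taking inverses once more gives the nontrivial inclusion. So finitely generated
  ideals may be replaced by finite sets of generators.\<close>

lemma Inv_hull:
  assumes "S \<subseteq> carrier K"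
  shows "Inv (submod hull S) = Inv S"
proof
  show "Inv (submod hull S) \<subseteq> Inv S"
    by (rule Inv_antimono) (rule hull_subset)
  have "submod hull S \<subseteq> Inv (Inv S)"
    using assms by (intro hull_minimal Inv_submod Inv_carrier subset_v)
  from Inv_antimono[OF this] show "Inv S \<subseteq> Inv (submod hull S)"
    using subset_v[OF Inv_carrier[of S]] by blast
qed

lemma v_def: "v_closure K D I = Inv (Inv I)"
  by (simp add: v_closure_def)

text \<open>The usual identity for an antitone Galois connection.\<close>

lemma Inv_v: "I \<subseteq> carrier K \<Longrightarrow> Inv (Inv (Inv I)) = Inv I"
  using subset_v[of I] subset_v[of "Inv I"] Inv_antimono[of I "Inv (Inv I)"] by auto

lemma Inv_D: "Inv D = D"
proof
  show "Inv D \<subseteq> D"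
  proof
    fix x assume "x \<in> Inv D"
    then have "x \<otimes> \<one> \<in> D" "x \<in> carrier K" unfolding Inv_iff by blast+
    then show "x \<in> D" by simp
  qed
qed (auto simp: Inv_iff)

lemma submod_hull: "S \<subseteq> carrier K \<Longrightarrow> submod (submod hull S)"
proof -
  assume S: "S \<subseteq> carrier K"
  have "submod hull S \<subseteq> carrier K"
    using S by (intro hull_minimal) (auto simp: submod_iff)
  then show ?thesis unfolding submod_iff[of "submod hull S"]
    unfolding hull_def using submodD by auto
qed

text \<open>By \<open>Inv_hull\<close> the v-closure of a finitely generated ideal depends only on
  its generators, and the ideal is nonzero exactly if some generator is.\<close>

lemma t_closure_submod:
  assumes I: "submod I" "I \<noteq> {\<zero>}"
  shows "I \<subseteq> t_closure K D I"
    and "t_closure K D I \<subseteq> J \<longleftrightarrow> (\<forall>S. finite S \<longrightarrow> S \<subseteq> I \<longrightarrow> \<not> S \<subseteq> {\<zero>} \<longrightarrow> Inv (Inv S) \<subseteq> J)"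
proof -
  have IK: "I \<subseteq> carrier K" using submodD(1)[OF I(1)] by blast
  have fg: "fg_fractional_ideal K D (submod hull S)" "submod hull S \<subseteq> I"
    if "finite S" "S \<subseteq> I" "\<not> S \<subseteq> {\<zero>}" for S
    using that IK hull_subset[of S submod] hull_minimal[of S I submod] I(1)
    unfolding fg_fractional_ideal_def by blast+
  have v: "Inv (Inv S) \<subseteq> t_closure K D I" if "finite S" "S \<subseteq> I" "\<not> S \<subseteq> {\<zero>}" for S
  proof -
    have "Inv (Inv S) = v_closure K D (submod hull S)"
      using that IK Inv_hull[of S] by (simp add: v_def)
    then show ?thesis using fg[OF that] unfolding t_closure_def by blast
  qed
  show "I \<subseteq> t_closure K D I"
  proof
    fix x assume x: "x \<in> I"
    \<comment> \<open>The extra nonzero generator keeps the ideal nonzero when \<open>x\<close> is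
      zero.\<close>
    obtain y where y: "y \<in> I" "y \<noteq> \<zero>" using I submodD(2)[OF I(1)] by blast
    have "{x, y} \<subseteq> Inv (Inv {x, y})" using x y IK by (intro subset_v) auto
    then show "x \<in> t_closure K D I" using v[of "{x, y}"] x y by auto
  qed
  show "t_closure K D I \<subseteq> J \<longleftrightarrow> (\<forall>S. finite S \<longrightarrow> S \<subseteq> I \<longrightarrow> \<not> S \<subseteq> {\<zero>} \<longrightarrow> Inv (Inv S) \<subseteq> J)"
    (is "_ \<longleftrightarrow> ?r")
  proof
    assume "t_closure K D I \<subseteq> J"
    then show ?r using v by blast
  next
    assume r: ?r
    show "t_closure K D I \<subseteq> J"
      unfolding t_closure_def
    proof clarify
      fix x E assume "x \<in> v_closure K D E" "E \<subseteq> I" "fg_fractional_ideal K D E"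
      then obtain S where S: "finite S" "S \<subseteq> carrier K" "E = submod hull S" "E \<noteq> {\<zero>}"
        unfolding fg_fractional_ideal_def by blast
      have "S \<subseteq> I" using S \<open>E \<subseteq> I\<close> hull_subset[of S submod] by blast
      moreover have "\<not> S \<subseteq> {\<zero>}"
      proof
        assume "S \<subseteq> {\<zero>}"
        moreover have "submod {\<zero>}" by (simp add: submod_iff)
          ultimately have "E \<subseteq> {\<zero>}" using S(3) hull_minimal[of S "{\<zero>}" submod] by simp
        then show False using S submodD(2)[OF submod_hull[of S]] by auto
      qed
      ultimately have "Inv (Inv S) \<subseteq> J" using r S by blast
      then show "x \<in> J" using \<open>x \<in> v_closure K D E\<close> S Inv_hull by (auto simp: v_def)
    qed
  qed
qed

lemma integral_t_ideal_iff:
  "integral_t_ideal K D I \<longleftrightarrow> I \<subseteq> D \<and> submod I \<and> I \<noteq> {\<zero>} \<and>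
    (\<forall>S. finite S \<longrightarrow> S \<subseteq> I \<longrightarrow> \<not> S \<subseteq> {\<zero>} \<longrightarrow> Inv (Inv S) \<subseteq> I)"
  (is "_ \<longleftrightarrow> ?a \<and> ?b \<and> ?c \<and> ?d")
proof (cases "?a \<and> ?b \<and> ?c")
  case True
  then have "t_closure K D I = I \<longleftrightarrow> ?d"
    using t_closure_submod(1)[of I] t_closure_submod(2)[of I I] by auto
  then show ?thesis using True unfolding integral_t_ideal_def ideal_iff by simp
qed (auto simp: integral_t_ideal_def ideal_iff)

text \<open>The double inverse is monotone, so that of a finite subset of \<open>I\<close> stays
  inside that of \<open>I\<close>.\<close>

lemma divisorial_t_ideal:
  assumes "I \<subseteq> D" "submod I" "I \<noteq> {\<zero>}" "Inv (Inv I) \<subseteq> I"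
  shows "integral_t_ideal K D I"
  unfolding integral_t_ideal_iff
proof (intro conjI allI impI)
  fix S assume "S \<subseteq> I"
  then have "Inv (Inv S) \<subseteq> Inv (Inv I)" by (intro Inv_antimono)
  then show "Inv (Inv S) \<subseteq> I" using assms(4) by simp
qed (use assms in auto)

text \<open>An inverse is divisorial by \<open>Inv_v\<close>. The t-ideals to which the domination
  hypothesis is applied, other than invertible ones, are obtained in this way.\<close>

lemma Inv_t_ideal:
  assumes "S \<subseteq> carrier K" "Inv S \<subseteq> D" "Inv S \<noteq> {\<zero>}"
  shows "integral_t_ideal K D (Inv S)"
  using assms Inv_submod[of S] Inv_v[of S] by (intro divisorial_t_ideal) simp_all

text \<open>Inverting \<open>Inv S \<subseteq> D\<close> gives
  \<open>D \<subseteq> Inv (Inv S)\<close>, and a t-ideal contains the latter. Both the factorial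
  and the Krull case produce such an \<open>S\<close> to refute properness.\<close>

lemma t_ideal_eq_D:
  assumes "integral_t_ideal K D I" "finite S" "S \<subseteq> I" "\<not> S \<subseteq> {\<zero>}" "Inv S \<subseteq> D"
  shows "I = D"
proof -
  have "D \<subseteq> Inv (Inv S)" using Inv_antimono[OF assms(5)] Inv_D by simp
  then show ?thesis using assms unfolding integral_t_ideal_iff by blast
qed

lemma proper_t_ideals_iff: "I \<in> proper_t_ideals K D \<longleftrightarrow> integral_t_ideal K D I \<and> I \<noteq> D"
  by (simp add: proper_t_ideals_def)

section \<open>Localizations at prime ideals\<close>

text \<open>Membership needs only a denominator outside \<open>N\<close>; no numerator has to be
  named.\<close>

lemma loc_iff:
  assumes "primeideal N DD"
  shows "x \<in> loc N \<longleftrightarrow> x \<in> carrier K \<and> (\<exists>s\<in>D - N. s \<otimes> x \<in> D)"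
proof
  assume "x \<in> loc N"
  then obtain a s where a: "x = a \<otimes> inv s" "a \<in> D" "s \<in> D" "s \<notin> N"
    unfolding localization_def by auto
  then have s: "s \<noteq> \<zero>" using primeD(4)[OF assms] by auto
  then have "s \<otimes> x = a" "x \<in> carrier K" using a m_lcomm[of s a "inv s"] field_inv[of s] by simp_all
  then show "x \<in> carrier K \<and> (\<exists>s\<in>D - N. s \<otimes> x \<in> D)" using a(2-4) by blast
next
  assume "x \<in> carrier K \<and> (\<exists>s\<in>D - N. s \<otimes> x \<in> D)"
  then obtain s where s: "x \<in> carrier K" "s \<in> D" "s \<notin> N" "s \<otimes> x \<in> D" by blast
  then have "s \<noteq> \<zero>" using primeD(4)[OF assms] by auto
  then have "(s \<otimes> x) \<otimes> inv s = x" using s eq_mult_inv_iff[of "s \<otimes> x" s x] m_comm[of s x] by simp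
  then have "x = (s \<otimes> x) \<otimes> inv s" by simp
  then show "x \<in> loc N" using s unfolding localization_def by blast
qed

lemma locI: "\<lbrakk>primeideal N DD; x \<in> carrier K; s \<in> D; s \<notin> N; s \<otimes> x \<in> D\<rbrakk> \<Longrightarrow> x \<in> loc N"
  using loc_iff by blast

lemma locE:
  assumes "primeideal N DD" "x \<in> loc N"
  obtains s where "s \<in> D" "s \<notin> N" "s \<otimes> x \<in> D" "x \<in> carrier K" "s \<noteq> \<zero>"
  using assms loc_iff primeD(4)[OF assms(1)] by blast

lemma D_loc: "primeideal N DD \<Longrightarrow> x \<in> D \<Longrightarrow> x \<in> loc N"
  using primeD(3)[of N] by (intro locI[of N x \<one>]) auto

lemma inv_loc:
  assumes "primeideal N DD" "s \<in> D" "s \<notin> N"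
  shows "inv s \<in> loc N"
proof -
  have "s \<noteq> \<zero>" using assms primeD(4) by auto
  then show ?thesis using assms field_inv[of s] by (intro locI[of N "inv s" s]) auto
qed

lemma loc_mono:
  assumes "primeideal M DD" "primeideal N DD" "N \<subseteq> M"
  shows "loc M \<subseteq> loc N"
  using assms(3) unfolding localization_def by blast

lemma loc_subring:
  assumes N: "primeideal N DD"
  shows "subring (loc N) K"
proof (rule subringI)
  show "loc N \<subseteq> carrier K" using loc_iff[OF N] by blast
  show "\<one> \<in> loc N" using D_loc[OF N] by simp
next
  fix x assume "x \<in> loc N"
  then obtain s where s: "s \<in> D" "s \<notin> N" "s \<otimes> x \<in> D" "x \<in> carrier K" by (rule locE[OF N])
  then have "s \<otimes> (\<ominus> x) = \<ominus> (s \<otimes> x)" using r_minus[of s x] by simp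
  then show "\<ominus> x \<in> loc N" using s by (intro locI[OF N, of _ s]) auto
next
  fix x y assume "x \<in> loc N" "y \<in> loc N"
  then obtain s t where s: "s \<in> D" "s \<notin> N" "s \<otimes> x \<in> D" "x \<in> carrier K"
    and t: "t \<in> D" "t \<notin> N" "t \<otimes> y \<in> D" "y \<in> carrier K"
    by (metis locE[OF N])
  have st: "s \<otimes> t \<in> D" "s \<otimes> t \<notin> N" using s t primeD(5)[OF N] by auto
  have "(s \<otimes> t) \<otimes> (x \<otimes> y) = (s \<otimes> x) \<otimes> (t \<otimes> y)"
    using s t by (simp add: m_ac)
  then show "x \<otimes> y \<in> loc N" using s t st by (intro locI[OF N, of _ "s \<otimes> t"]) auto
  have "(s \<otimes> t) \<otimes> (x \<oplus> y) = t \<otimes> (s \<otimes> x) \<oplus> s \<otimes> (t \<otimes> y)"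
    using s t by (simp add: r_distr m_ac)
  then show "x \<oplus> y \<in> loc N" using s t st by (intro locI[OF N, of _ "s \<otimes> t"]) auto
qed

lemma loc_closed:
  assumes "primeideal N DD"
  shows "x \<in> loc N \<Longrightarrow> x \<in> carrier K" "\<lbrakk>x \<in> loc N; y \<in> loc N\<rbrakk> \<Longrightarrow> x \<otimes> y \<in> loc N"
    "\<lbrakk>x \<in> loc N; y \<in> loc N\<rbrakk> \<Longrightarrow> x \<oplus> y \<in> loc N"
  using subringE[OF loc_subring[OF assms]] by auto

lemma loc_domain: "primeideal N DD \<Longrightarrow> domain (K\<lparr>carrier := loc N\<rparr>)"
  by (rule subring_is_domain[OF loc_subring])

lemma loc_Units_iff:
  "primeideal N DD \<Longrightarrow> u \<in> Units (K\<lparr>carrier := loc N\<rparr>) \<longleftrightarrow> u \<in> loc N \<and> u \<noteq> \<zero> \<and> inv u \<in> loc N"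
  by (rule subring_Units_iff[OF loc_subring])

section \<open>Products of submodules and invertible ideals\<close>

text \<open>An additive condition on \<open>x \<otimes> w\<close> has to be checked only on the
  generating products \<open>i \<otimes> j\<close>. Membership of \<open>w\<close> in the carrier is
  carried along because distributivity requires it in the induction.\<close>

lemma ideal_prod_scale:
  assumes "w \<in> ideal_prod K I J" "I \<subseteq> carrier K" "J \<subseteq> carrier K" "x \<in> carrier K"
    and mem: "\<And>i j. \<lbrakk>i \<in> I; j \<in> J\<rbrakk> \<Longrightarrow> x \<otimes> (i \<otimes> j) \<in> T"
    and add: "\<And>a b. \<lbrakk>a \<in> T; b \<in> T\<rbrakk> \<Longrightarrow> a \<oplus> b \<in> T"
  shows "w \<in> carrier K \<and> x \<otimes> w \<in> T"
  using assms(1)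
proof induct
  case (prod i j)
  then show ?case using assms(2,3) mem by auto
next
  case (sum s t)
  then show ?case using assms(4) add by (simp add: r_distr)
qed

text \<open>Writing \<open>\<one>\<close> as a sum of products \<open>i \<otimes> j\<close> and
  multiplying by \<open>x\<close> expresses \<open>x\<close> as a sum of elements of
  \<open>T\<close>. With \<open>J = Inv I\<close> this is how invertibility of \<open>I\<close> is
  exploited.\<close>

lemma ideal_prod_one_mem:
  assumes "\<one> \<in> ideal_prod K I J" "I \<subseteq> carrier K" "J \<subseteq> carrier K" "x \<in> carrier K"
    and mem: "\<And>i j. \<lbrakk>i \<in> I; j \<in> J\<rbrakk> \<Longrightarrow> x \<otimes> (i \<otimes> j) \<in> T"
    and add: "\<And>a b. \<lbrakk>a \<in> T; b \<in> T\<rbrakk> \<Longrightarrow> a \<oplus> b \<in> T"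
  shows "x \<in> T"
  using ideal_prod_scale[OF assms] assms(4) by simp

lemma ideal_prod_subset:
  assumes "\<And>i j. \<lbrakk>i \<in> I; j \<in> J\<rbrakk> \<Longrightarrow> i \<otimes> j \<in> T" "\<And>a b. \<lbrakk>a \<in> T; b \<in> T\<rbrakk> \<Longrightarrow> a \<oplus> b \<in> T"
  shows "ideal_prod K I J \<subseteq> T"
proof
  fix w assume "w \<in> ideal_prod K I J"
  then show "w \<in> T" by induct (use assms in auto)
qed

lemma ideal_prod_submod:
  assumes "submod I" "submod J"
  shows "submod (ideal_prod K I J)"
  unfolding submod_iff
proof (intro conjI ballI)
  show "ideal_prod K I J \<subseteq> carrier K"
    using submodD(1)[OF assms(1)] submodD(1)[OF assms(2)] by (intro ideal_prod_subset) auto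
  show "\<zero> \<in> ideal_prod K I J"
    using ideal_prod.prod[of \<zero> I \<zero> J K] submodD(2)[OF assms(1)] submodD(2)[OF assms(2)] by simp
next
  fix d x assume "d \<in> D" "x \<in> ideal_prod K I J"
  have "d \<otimes> (i \<otimes> j) \<in> ideal_prod K I J" if "i \<in> I" "j \<in> J" for i j
  proof -
    have "(d \<otimes> i) \<otimes> j \<in> ideal_prod K I J"
      using that \<open>d \<in> D\<close> submodD(4)[OF assms(1)] by (intro ideal_prod.prod) auto
    then show ?thesis
      using m_assoc[of d i j] that \<open>d \<in> D\<close> submodD(1)[OF assms(1)] submodD(1)[OF assms(2)] by simp
  qed
  then show "d \<otimes> x \<in> ideal_prod K I J"
    using ideal_prod_scale[OF \<open>x \<in> _\<close>, of d "ideal_prod K I J"] \<open>d \<in> D\<close>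
      submodD(1)[OF assms(1)] submodD(1)[OF assms(2)] ideal_prod.sum[of _ K I J] by auto
qed (rule ideal_prod.sum)

text \<open>Asking only for \<open>\<one>\<close> suffices: the product of \<open>I\<close> with its
  inverse is always an ideal contained in \<open>D\<close>. The agreement with
  \<open>proper_invertible\<close> is \<open>proper_invertible_iff\<close>.\<close>

definition invertible :: "'a set \<Rightarrow> bool" where
  "invertible I \<longleftrightarrow> I \<subseteq> D \<and> submod I \<and> \<one> \<in> ideal_prod K I (Inv I)"

lemma invertibleD:
  assumes "invertible I"
  shows "I \<subseteq> D" "submod I" "\<one> \<in> ideal_prod K I (Inv I)" "I \<subseteq> carrier K"
  using assms unfolding invertible_def by auto

lemma ideal_prod_Inv:
  assumes "submod I"
  shows "ideal_prod K I (Inv I) \<subseteq> D"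
proof (rule ideal_prod_subset)
  fix i j assume "i \<in> I" "j \<in> Inv I"
  then show "i \<otimes> j \<in> D" using submodD(1)[OF assms] m_comm[of i j] by (auto simp: Inv_iff)
qed auto

lemma submod_eq_D: "submod I \<Longrightarrow> I \<subseteq> D \<Longrightarrow> \<one> \<in> I \<Longrightarrow> I = D"
proof (erule equalityI, rule subsetI)
  fix x assume "submod I" "\<one> \<in> I" "x \<in> D"
  then have "x \<otimes> \<one> \<in> I" by (intro submodD(4))
  then show "x \<in> I" using \<open>x \<in> D\<close> by simp
qed

lemma proper_invertible_iff: "proper_invertible K D I \<longleftrightarrow> invertible I \<and> I \<noteq> D"
proof -
  have "ideal_prod K I (Inv I) = D \<longleftrightarrow> \<one> \<in> ideal_prod K I (Inv I)" if "submod I"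
  proof -
    have "submod (ideal_prod K I (Inv I))"
      using that submodD(1)[OF that] by (intro ideal_prod_submod Inv_submod) auto
    then show ?thesis using submod_eq_D ideal_prod_Inv[OF that] by auto
  qed
  then show ?thesis unfolding proper_invertible_def invertible_def ideal_iff by auto
qed

lemma invertible_ideal_prod: "invertible I \<Longrightarrow> ideal_prod K I (Inv I) = D"
  by (intro submod_eq_D ideal_prod_submod ideal_prod_Inv Inv_submod) (use invertibleD in blast)+

lemma invertible_nonzero:
  assumes "invertible I" shows "I \<noteq> {\<zero>}"
proof
  assume "I = {\<zero>}"
  then have "ideal_prod K I (Inv I) \<subseteq> {\<zero>}"
    by (intro ideal_prod_subset) (auto simp: Inv_iff)
  then show False using invertibleD(3)[OF assms] by auto
qed

text \<open>For \<open>x\<close> in the double inverse and \<open>j \<in> Inv I\<close> the product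
  \<open>x \<otimes> j\<close> lies in \<open>D\<close>, so
  \<open>x \<otimes> (i \<otimes> j)\<close> lies in \<open>I\<close>; summing up to
  \<open>\<one>\<close> gives \<open>x \<in> I\<close>.\<close>

lemma invertible_v:
  assumes I: "invertible I" shows "Inv (Inv I) \<subseteq> I"
proof
  fix x assume x: "x \<in> Inv (Inv I)"
  then have xK: "x \<in> carrier K" by (simp add: Inv_iff)
  have "x \<otimes> (i \<otimes> j) \<in> I" if "i \<in> I" "j \<in> Inv I" for i j
  proof -
    have c: "i \<in> carrier K" "j \<in> carrier K" using that invertibleD[OF I] by (auto simp: Inv_iff)
    have "x \<otimes> j \<in> D" using x that by (auto simp: Inv_iff)
    then have "(x \<otimes> j) \<otimes> i \<in> I" using that submodD[OF invertibleD(2)[OF I]] by auto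
    moreover have "(x \<otimes> j) \<otimes> i = x \<otimes> (i \<otimes> j)" using c xK by (simp add: m_ac)
    ultimately show ?thesis by simp
  qed
  then show "x \<in> I"
    using ideal_prod_one_mem[OF invertibleD(3,4)[OF I] _ xK, of I] submodD(3)[OF invertibleD(2)[OF I]]
    by auto
qed

lemma invertible_t_ideal: "invertible I \<Longrightarrow> integral_t_ideal K D I"
  by (intro divisorial_t_ideal invertibleD invertible_v invertible_nonzero)

lemma invertible_D: "invertible D"
proof -
  have "submod D" unfolding submod_iff by auto
  moreover have "\<one> \<otimes> \<one> \<in> ideal_prod K D (Inv D)" by (intro ideal_prod.prod) (auto simp: Inv_D)
  ultimately show ?thesis unfolding invertible_def by auto
qed

text \<open>The product with the inverse is already \<open>D\<close>, which is a t-ideal. Hence the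
  chain condition on t-invertible t-ideals applies to invertible ideals.\<close>

lemma invertible_t_invertible:
  assumes "invertible I" shows "t_invertible K D I"
  using invertible_t_ideal[OF invertible_D] invertible_ideal_prod[OF assms]
  unfolding t_invertible_def integral_t_ideal_def by simp

lemma principal_iff:
  assumes "a \<in> carrier K" "a \<noteq> \<zero>"
  shows "y \<in> (\<lambda>d. d \<otimes> a) ` D \<longleftrightarrow> y \<in> carrier K \<and> y \<otimes> inv a \<in> D"
proof
  assume "y \<in> (\<lambda>d. d \<otimes> a) ` D"
  then obtain d where "d \<in> D" "y = d \<otimes> a" by blast
  then show "y \<in> carrier K \<and> y \<otimes> inv a \<in> D" using eq_mult_inv_iff[of y a d] assms by simp
next
  assume y: "y \<in> carrier K \<and> y \<otimes> inv a \<in> D"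
  then have "y = (y \<otimes> inv a) \<otimes> a" using eq_mult_inv_iff[of y a "y \<otimes> inv a"] assms by simp
  then show "y \<in> (\<lambda>d. d \<otimes> a) ` D" using y by blast
qed

lemma principal_invertible:
  assumes "a \<in> D" "a \<noteq> \<zero>"
  shows "invertible ((\<lambda>d. d \<otimes> a) ` D)"
proof -
  let ?I = "(\<lambda>d. d \<otimes> a) ` D"
  note iff = principal_iff[OF D_closed(1)[OF assms(1)] assms(2)]
  have i: "inv a \<in> carrier K" "a \<otimes> inv a = \<one>" using field_inv[of a] assms by auto
  have "submod ?I" unfolding submod_iff
  proof (intro conjI ballI)
    fix x y assume "x \<in> ?I" "y \<in> ?I"
    then show "x \<oplus> y \<in> ?I" unfolding iff using i(1) by (auto simp: l_distr)
  next
    fix d x assume "d \<in> D" "x \<in> ?I"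
    then show "d \<otimes> x \<in> ?I" unfolding iff using i(1) by (auto simp: m_assoc)
  qed (use assms i iff in auto)
  moreover have "?I \<subseteq> D" using assms by auto
  moreover have "a \<otimes> inv a \<in> ideal_prod K ?I (Inv ?I)"
  proof (rule ideal_prod.prod)
    show "a \<in> ?I" unfolding iff using assms i by auto
    show "inv a \<in> Inv ?I" unfolding Inv_iff
    proof (intro conjI ballI)
      fix y assume "y \<in> ?I"
      then show "inv a \<otimes> y \<in> D" unfolding iff using i m_comm[of "inv a" y] by auto
    qed (rule i)
  qed
  ultimately show ?thesis using i unfolding invertible_def by auto
qed

lemma principal_self: "a \<in> D \<Longrightarrow> a \<in> (\<lambda>d. d \<otimes> a) ` D"
  by (auto simp: image_iff intro!: bexI[of _ \<one>])

lemma principal_subset: "\<lbrakk>submod I; a \<in> I\<rbrakk> \<Longrightarrow> (\<lambda>d. d \<otimes> a) ` D \<subseteq> I"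
  using submodD(4) by auto

text \<open>To contain is to divide for invertible ideals. The strict inclusion
  \<open>I \<subset> J\<close> is what lets an induction along ascending chains pass from
  \<open>I\<close> to the cofactor \<open>J\<close>.\<close>

lemma invertible_quotient:
  assumes I: "invertible I" and A: "invertible A" and "I \<subseteq> A" "A \<noteq> D"
  shows "\<exists>J. invertible J \<and> I \<subset> J \<and> ideal_prod K A J = I"
proof -
  \<comment> \<open>The colon module of \<open>I\<close> by \<open>A\<close>, which is the product
    of \<open>I\<close> with \<open>Inv A\<close>.\<close>
  define J where "J = {x \<in> carrier K. \<forall>y\<in>A. x \<otimes> y \<in> I}"
  note I' = invertibleD[OF I] submodD[OF invertibleD(2)[OF I]]
  note A' = invertibleD[OF A] submodD[OF invertibleD(2)[OF A]]
  have JK: "J \<subseteq> carrier K" by (auto simp: J_def)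
  have "submod J" unfolding submod_iff
  proof (intro conjI ballI)
    show "J \<subseteq> carrier K" "\<zero> \<in> J" using A'(4) I'(6) by (auto simp: J_def)
  next
    fix x y assume "x \<in> J" "y \<in> J"
    then show "x \<oplus> y \<in> J" using A'(4) I'(7) by (auto simp: J_def l_distr subset_iff)
  next
    fix d x assume "d \<in> D" "x \<in> J"
    then show "d \<otimes> x \<in> J" using A'(4) I'(8) by (auto simp: J_def m_assoc subset_iff)
  qed
  have IJ: "I \<subseteq> J" using A'(1) I'(5,9) by (auto simp: J_def)
  \<comment> \<open>An element of \<open>J\<close> multiplies \<open>A\<close> into
    \<open>I \<subseteq> A\<close>, and multipliers of the invertible ideal \<open>A\<close> lie in
    \<open>D\<close>.\<close>
  have JD: "J \<subseteq> D"
  proof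
    fix x assume x: "x \<in> J"
    have "x \<otimes> (a \<otimes> b) \<in> D" if "a \<in> A" "b \<in> Inv A" for a b
    proof -
      have "x \<otimes> a \<in> A" using x that assms(3) by (auto simp: J_def)
      then have "b \<otimes> (x \<otimes> a) \<in> D" using that by (auto simp: Inv_iff)
      moreover have "b \<otimes> (x \<otimes> a) = x \<otimes> (a \<otimes> b)"
        using x that A'(4) JK by (auto simp: Inv_iff m_ac subset_iff)
      ultimately show ?thesis by simp
    qed
    then show "x \<in> D"
      using ideal_prod_one_mem[OF A'(3,4), of x D] x JK by auto
  qed
  have AJ: "ideal_prod K A J = I"
  proof
    show "ideal_prod K A J \<subseteq> I"
    proof (rule ideal_prod_subset)
      fix a x assume "a \<in> A" "x \<in> J"
      moreover from this have "a \<in> carrier K" "x \<in> carrier K" using A'(4) JK by auto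
      ultimately show "a \<otimes> x \<in> I" using m_comm[of a x] by (auto simp: J_def)
    qed (rule I'(7))
  next
    show "I \<subseteq> ideal_prod K A J"
    proof
      fix y assume y: "y \<in> I"
      have "y \<otimes> (a \<otimes> b) \<in> ideal_prod K A J" if "a \<in> A" "b \<in> Inv A" for a b
      proof -
        have c: "y \<in> carrier K" "a \<in> carrier K" "b \<in> carrier K"
          using y that A'(4) I'(4) by (auto simp: Inv_iff)
        have "y \<otimes> b \<in> J"
          unfolding J_def
        proof (intro CollectI conjI ballI)
          fix z assume z: "z \<in> A"
          then have "b \<otimes> z \<in> D" using that by (auto simp: Inv_iff)
          then have "y \<otimes> (b \<otimes> z) \<in> I" using y by (intro I'(9))
          moreover have "z \<in> carrier K" using z A'(4) by auto
          ultimately show "y \<otimes> b \<otimes> z \<in> I" using c m_assoc[of y b z] by simp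
        qed (use c in auto)
        then have "a \<otimes> (y \<otimes> b) \<in> ideal_prod K A J" using that by (intro ideal_prod.prod)
        moreover have "a \<otimes> (y \<otimes> b) = y \<otimes> (a \<otimes> b)" using c m_lcomm by simp
        ultimately show ?thesis by simp
      qed
      then show "y \<in> ideal_prod K A J"
        using ideal_prod_one_mem[OF A'(3,4), of y "ideal_prod K A J"] y I'(4)
          ideal_prod.sum[of _ K A J] by auto
    qed
  qed
  \<comment> \<open>Multiply the representations of \<open>\<one>\<close> for \<open>A\<close> and
    for \<open>I\<close> and regroup: \<open>i \<otimes> b\<close> lies in \<open>J\<close>, and
    \<open>a \<otimes> z\<close> lies in \<open>Inv J\<close>. The sum over \<open>i\<close>,
    \<open>z\<close> is taken first, then that over \<open>a\<close>, \<open>b\<close>.\<close>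
  have "\<one> \<in> ideal_prod K J (Inv J)"
  proof -
    have 1: "(a \<otimes> b) \<otimes> (i \<otimes> z) \<in> ideal_prod K J (Inv J)"
      if ab: "a \<in> A" "b \<in> Inv A" and iz: "i \<in> I" "z \<in> Inv I" for a b i z
    proof -
      have c: "a \<in> carrier K" "b \<in> carrier K" "i \<in> carrier K" "z \<in> carrier K"
        using that A'(4) I'(4) by (auto simp: Inv_iff)
      have "i \<otimes> b \<in> J"
        unfolding J_def
      proof (intro CollectI conjI ballI)
        fix y assume y: "y \<in> A"
        then have "b \<otimes> y \<in> D" using ab by (auto simp: Inv_iff)
        then have "i \<otimes> (b \<otimes> y) \<in> I" using iz by (intro I'(9))
        moreover have "y \<in> carrier K" using y A'(4) by auto
        ultimately show "i \<otimes> b \<otimes> y \<in> I" using c m_assoc[of i b y] by simp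
      qed (use c in auto)
      moreover have "a \<otimes> z \<in> Inv J"
        unfolding Inv_iff
      proof (intro conjI ballI)
        fix x assume x: "x \<in> J"
        then have "x \<otimes> a \<in> I" using ab by (auto simp: J_def)
        then have "z \<otimes> (x \<otimes> a) \<in> D" using iz by (auto simp: Inv_iff)
        moreover have "z \<otimes> (x \<otimes> a) = a \<otimes> z \<otimes> x" using c x JK by (auto simp: m_ac subset_iff)
        ultimately show "a \<otimes> z \<otimes> x \<in> D" by simp
      qed (use c in auto)
      ultimately have "(i \<otimes> b) \<otimes> (a \<otimes> z) \<in> ideal_prod K J (Inv J)" by (rule ideal_prod.prod)
      moreover have "(i \<otimes> b) \<otimes> (a \<otimes> z) = (a \<otimes> b) \<otimes> (i \<otimes> z)" using c by (simp add: m_ac)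
      ultimately show ?thesis by simp
    qed
    have 2: "a \<otimes> b \<in> ideal_prod K J (Inv J)" if "a \<in> A" "b \<in> Inv A" for a b
      using ideal_prod_one_mem[OF I'(3,4), of "a \<otimes> b" "ideal_prod K J (Inv J)"] that 1
        ideal_prod.sum[of _ K J "Inv J"] A'(4) by (auto simp: Inv_iff)
    then show ?thesis
      using ideal_prod_subset[of A "Inv A" "ideal_prod K J (Inv J)"] A'(3)
        ideal_prod.sum[of _ K J "Inv J"] by auto
  qed
  then have "invertible J" using JD \<open>submod J\<close> unfolding invertible_def by auto
  \<comment> \<open>Otherwise \<open>I\<close> equals its product with \<open>A\<close>, and
    multiplying by \<open>Inv I\<close> puts \<open>\<one>\<close> into \<open>A\<close>.\<close>
  moreover have "I \<noteq> J"
  proof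
    assume "I = J"
    have "\<one> \<otimes> (i \<otimes> z) \<in> A" if iz: "i \<in> I" "z \<in> Inv I" for i z
    proof -
      have zK: "z \<in> carrier K" using iz by (auto simp: Inv_iff)
      have "z \<otimes> i \<in> A"
      proof (rule ideal_prod_scale[THEN conjunct2])
        show "i \<in> ideal_prod K A I" using AJ \<open>I = J\<close> iz by simp
      next
        fix a x assume ax: "a \<in> A" "x \<in> I"
        then have "z \<otimes> x \<in> D" using iz by (auto simp: Inv_iff)
        then have "a \<otimes> (z \<otimes> x) \<in> A" using ax by (intro A'(9))
        moreover have "a \<in> carrier K" "x \<in> carrier K" using ax A'(4) I'(4) by auto
        then have "a \<otimes> (z \<otimes> x) = z \<otimes> (a \<otimes> x)" using zK by (simp add: m_lcomm)
        ultimately show "z \<otimes> (a \<otimes> x) \<in> A" by simp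
      qed (use A'(4,7) I'(4) zK in auto)
      then show ?thesis using m_comm[of i z] zK iz I'(4) by auto
    qed
    then have "\<one> \<in> A" using ideal_prod_one_mem[OF I'(3,4), of \<one> A] A'(7) by auto
    then show False using submod_eq_D A'(1,2) assms(4) by blast
  qed
  ultimately show ?thesis using IJ AJ by blast
qed

section \<open>Local generators of invertible ideals\<close>

text \<open>Says that \<open>f \<in> I\<close> generates the extension of \<open>I\<close> to
  \<open>loc N\<close>, without forming that extension.\<close>

definition local_gen :: "'a set \<Rightarrow> 'a set \<Rightarrow> 'a \<Rightarrow> bool" where
  "local_gen N I f \<longleftrightarrow> f \<in> I \<and> f \<noteq> \<zero> \<and> (\<forall>y\<in>I. y \<otimes> inv f \<in> loc N)"

text \<open>Some product \<open>f \<otimes> g\<close> with \<open>f \<in> I\<close> and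
  \<open>g \<in> Inv I\<close> avoids \<open>N\<close>, since otherwise
  \<open>\<one> \<in> N\<close>. This product is a denominator of \<open>y \<otimes> inv f\<close>
  for every \<open>y \<in> I\<close>, because it turns it into \<open>g \<otimes> y\<close>.\<close>

lemma local_gen_exists:
  assumes N: "primeideal N DD" and I: "invertible I"
  shows "\<exists>f. local_gen N I f"
proof -
  have "\<exists>f\<in>I. \<exists>g\<in>Inv I. f \<otimes> g \<notin> N"
  proof (rule ccontr)
    assume "\<not> ?thesis"
    then have "\<one> \<in> N"
      using ideal_prod_subset[of I "Inv I" N] submodD(3)[OF primeD(2)[OF N]] invertibleD(3)[OF I] by blast
    then show False using primeD(3)[OF N] by simp
  qed
  then obtain f g where f: "f \<in> I" "g \<in> Inv I" "f \<otimes> g \<notin> N" by blast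
  have fK: "f \<in> carrier K" "g \<in> carrier K" using f invertibleD(4)[OF I] by (auto simp: Inv_iff)
  have f0: "f \<noteq> \<zero>" using f primeD(4)[OF N] fK by auto
  have "y \<otimes> inv f \<in> loc N" if "y \<in> I" for y
  proof (rule locI[OF N])
    have yK: "y \<in> carrier K" using that invertibleD(4)[OF I] by auto
    then show "y \<otimes> inv f \<in> carrier K" using field_inv[of f] fK f0 by simp
    show "f \<otimes> g \<in> D" using ideal_prod_Inv[OF invertibleD(2)[OF I]] f ideal_prod.prod[of f I g "Inv I" K] by blast
    have "f \<otimes> g \<otimes> (y \<otimes> inv f) = (f \<otimes> inv f) \<otimes> (g \<otimes> y)"
      using fK yK field_inv(1)[of f] f0 by (simp add: m_ac)
    also have "\<dots> = g \<otimes> y" using fK yK field_inv[of f] f0 by simp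
    finally show "f \<otimes> g \<otimes> (y \<otimes> inv f) \<in> D" using f that by (auto simp: Inv_iff)
  qed (rule f)
  then show ?thesis using f f0 unfolding local_gen_def by blast
qed

lemma local_gen_mult:
  assumes N: "primeideal N DD" and "A \<subseteq> carrier K" "J \<subseteq> carrier K"
    and f: "local_gen N A f" and g: "local_gen N J g"
  shows "local_gen N (ideal_prod K A J) (f \<otimes> g)"
proof -
  have fK: "f \<in> carrier K" "f \<noteq> \<zero>" "g \<in> carrier K" "g \<noteq> \<zero>"
    using assms unfolding local_gen_def by auto
  then have fg: "f \<otimes> g \<noteq> \<zero>" by (simp add: integral_iff)
  note i = field_inv[of f] field_inv[of g]
  have "inv (f \<otimes> g) \<otimes> y \<in> loc N" if "y \<in> ideal_prod K A J" for y
  proof (rule ideal_prod_scale[OF that assms(2,3), THEN conjunct2])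
    fix a b assume ab: "a \<in> A" "b \<in> J"
    then have "(a \<otimes> inv f) \<otimes> (b \<otimes> inv g) \<in> loc N"
      using f g loc_closed(2)[OF N] unfolding local_gen_def by auto
    moreover have "a \<in> carrier K" "b \<in> carrier K" using ab assms by auto
    then have "(a \<otimes> inv f) \<otimes> (b \<otimes> inv g) = inv (f \<otimes> g) \<otimes> (a \<otimes> b)"
      using fK i by (simp add: inv_mult m_ac)
    ultimately show "inv (f \<otimes> g) \<otimes> (a \<otimes> b) \<in> loc N" by simp
  qed (use fK fg field_inv[of "f \<otimes> g"] loc_closed(3)[OF N] in auto)
  moreover have "inv (f \<otimes> g) \<otimes> y = y \<otimes> inv (f \<otimes> g)" if "y \<in> ideal_prod K A J" for y
  proof -
    have "ideal_prod K A J \<subseteq> carrier K" using assms(2,3) by (intro ideal_prod_subset) auto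
    then show ?thesis using that fK fg field_inv(1)[of "f \<otimes> g"] m_comm[of "inv (f \<otimes> g)" y] by auto
  qed
  ultimately show ?thesis
    using fg f g unfolding local_gen_def by (auto intro: ideal_prod.prod)
qed

text \<open>The extension of \<open>A\<close> to \<open>loc N\<close> is a prime ideal because
  \<open>A \<subseteq> N\<close>, and \<open>f\<close> generates it.\<close>

lemma local_gen_prime:
  assumes N: "primeideal N DD" and A: "primeideal A DD" and "A \<subseteq> N" and f: "local_gen N A f"
  shows "ring_prime\<^bsub>K\<lparr>carrier := loc N\<rparr>\<^esub> f"
proof -
  have fA: "f \<in> A" "f \<noteq> \<zero>" "f \<in> D" "f \<in> carrier K" "inv f \<in> carrier K" "f \<otimes> inv f = \<one>"
    using f primeD(1)[OF A] field_inv[of f] unfolding local_gen_def by auto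
  \<comment> \<open>The extension of \<open>A\<close> contracts back to \<open>A\<close>: a
    denominator outside \<open>N\<close> is outside \<open>A\<close>, so primality cancels
    it.\<close>
  have mem: "a \<otimes> inv f \<in> loc N \<longleftrightarrow> a \<in> A" if a: "a \<in> D" for a
  proof
    assume "a \<otimes> inv f \<in> loc N"
    then obtain r where r: "r \<in> D" "r \<notin> N" "r \<otimes> (a \<otimes> inv f) \<in> D" by (rule locE[OF N])
    then have "r \<otimes> (a \<otimes> inv f) \<otimes> f \<in> A" using fA submodD(4)[OF primeD(2)[OF A]] by blast
    moreover have "r \<otimes> (a \<otimes> inv f) \<otimes> f = (f \<otimes> inv f) \<otimes> (r \<otimes> a)"
      using fA(4,5) r(1) a by (simp add: m_ac)
    ultimately have "r \<otimes> a \<in> A" using fA r(1) a by simp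
    then show "a \<in> A" using primeD(5)[OF A r(1) a] r \<open>A \<subseteq> N\<close> by blast
  qed (use f in \<open>auto simp: local_gen_def\<close>)
  show ?thesis
    unfolding subring_ring_prime_iff[OF loc_subring[OF N] D_loc[OF N fA(3)]]
  proof (intro conjI ballI impI)
    show "inv f \<notin> loc N" using mem[of \<one>] primeD(3)[OF A] fA by auto
  next
    fix u v assume uv: "u \<in> loc N" "v \<in> loc N" "u \<otimes> v \<otimes> inv f \<in> loc N"
    obtain s where s: "s \<in> D" "s \<notin> N" "s \<otimes> u \<in> D" "u \<in> carrier K" "s \<noteq> \<zero>" by (rule locE[OF N uv(1)])
    obtain t where t: "t \<in> D" "t \<notin> N" "t \<otimes> v \<in> D" "v \<in> carrier K" "t \<noteq> \<zero>" by (rule locE[OF N uv(2)])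
    have cancel: "w \<otimes> inv f \<in> loc N" if "r \<in> D" "r \<notin> N" "r \<otimes> w \<in> A" "w \<in> carrier K" for r w
    proof -
      have "r \<noteq> \<zero>" using that primeD(4)[OF N] by auto
      then have i: "inv r \<in> carrier K" "inv r \<otimes> r = \<one>" using field_inv[of r] that by auto
      have "inv r \<otimes> (r \<otimes> w \<otimes> inv f) \<in> loc N"
        using that f inv_loc[OF N, of r] loc_closed(2)[OF N, of "inv r"] by (auto simp: local_gen_def)
      moreover have "inv r \<otimes> (r \<otimes> w \<otimes> inv f) = (inv r \<otimes> r) \<otimes> (w \<otimes> inv f)"
        using i(1) that fA(5) by (simp add: m_assoc)
      ultimately show ?thesis using i that fA by simp
    qed
    have "s \<otimes> t \<otimes> (u \<otimes> v \<otimes> inv f) \<in> loc N"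
      using s t uv(3) D_loc[OF N] loc_closed(2)[OF N, of "s \<otimes> t"] by simp
    moreover have "s \<otimes> t \<otimes> (u \<otimes> v \<otimes> inv f) = (s \<otimes> u) \<otimes> (t \<otimes> v) \<otimes> inv f"
      using s t fA(5) by (simp add: m_ac)
    ultimately have "(s \<otimes> u) \<otimes> (t \<otimes> v) \<in> A" using mem s t by simp
    then have "s \<otimes> u \<in> A \<or> t \<otimes> v \<in> A" using primeD(5)[OF A] s t by blast
    then show "u \<otimes> inv f \<in> loc N \<or> v \<otimes> inv f \<in> loc N" using cancel s t by blast
  qed (rule fA)
qed

text \<open>An element \<open>y\<close> of \<open>A\<close> outside \<open>N\<close> is invertible
  in \<open>loc N\<close>, and \<open>f\<close> divides it there.\<close>

lemma local_gen_unit: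
  assumes N: "primeideal N DD" and A: "A \<subseteq> D" "\<not> A \<subseteq> N" and f: "local_gen N A f"
  shows "f \<in> Units (K\<lparr>carrier := loc N\<rparr>)"
proof -
  obtain y where y: "y \<in> A" "y \<notin> N" using A by blast
  then have yD: "y \<in> D" "y \<noteq> \<zero>" using A primeD(4)[OF N] by auto
  have fD: "f \<in> D" "f \<noteq> \<zero>" using f A unfolding local_gen_def by auto
  have "inv y \<otimes> (y \<otimes> inv f) \<in> loc N"
    using y yD f inv_loc[OF N] loc_closed(2)[OF N, of "inv y"] by (auto simp: local_gen_def)
  moreover have "inv y \<otimes> (y \<otimes> inv f) = inv f"
    using yD fD field_inv[of y] field_inv[of f] by (simp add: m_assoc[symmetric])
  ultimately show ?thesis using fD D_loc[OF N] unfolding loc_Units_iff[OF N] by simp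
qed

lemma local_gen_associated:
  assumes N: "primeideal N DD" and A: "A \<subseteq> carrier K" and f: "local_gen N A f" and g: "local_gen N A g"
  shows "\<exists>u\<in>Units (K\<lparr>carrier := loc N\<rparr>). g = u \<otimes> f"
proof -
  have fK: "f \<in> carrier K" "f \<noteq> \<zero>" "g \<in> carrier K" "g \<noteq> \<zero>"
    using assms unfolding local_gen_def by auto
  note i = field_inv[of f] field_inv[of g]
  have 1: "inv (g \<otimes> inv f) = f \<otimes> inv g"
  proof -
    have "(f \<otimes> inv g) \<otimes> (g \<otimes> inv f) = (f \<otimes> inv f) \<otimes> (inv g \<otimes> g)"
      using fK i(1,5) by (simp add: m_ac)
    then have "\<one> = (f \<otimes> inv g) \<otimes> (g \<otimes> inv f)" using fK i by simp
    then show ?thesis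
      using comm_inv_char[of "g \<otimes> inv f" "f \<otimes> inv g"] fK i(1,5) m_comm[of "g \<otimes> inv f" "f \<otimes> inv g"]
      by simp
  qed
  have "g \<otimes> inv f \<in> Units (K\<lparr>carrier := loc N\<rparr>)"
    unfolding loc_Units_iff[OF N] 1 using f g fK i by (auto simp: local_gen_def integral_iff)
  moreover have "g = (g \<otimes> inv f) \<otimes> f" using fK i by (simp add: m_assoc)
  ultimately show ?thesis by blast
qed

section \<open>In a factorial domain, proper t-ideals lie in principal primes\<close>

lemma DD_ring_prime_iff:
  assumes "p \<in> D"
  shows "ring_prime\<^bsub>DD\<^esub> p \<longleftrightarrow> p \<noteq> \<zero> \<and> inv p \<notin> D \<and>
    (\<forall>a\<in>D. \<forall>b\<in>D. a \<otimes> b \<otimes> inv p \<in> D \<longrightarrow> a \<otimes> inv p \<in> D \<or> b \<otimes> inv p \<in> D)"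
  by (rule subring_ring_prime_iff[OF D_subring assms])

text \<open>If no principal prime contains \<open>I\<close>, every prime factor of a nonzero
  \<open>x \<in> I\<close> fails to divide some element of \<open>I\<close>. Finitely many such
  elements together with \<open>x\<close> have their inverse inside \<open>D\<close>, which forces
  \<open>I = D\<close>.\<close>

lemma factorial_t_ideal_subset_prime:
  assumes fact: "factorial_domain DD" and I: "integral_t_ideal K D I" "I \<noteq> D"
  shows "\<exists>p\<in>D. ring_prime\<^bsub>DD\<^esub> p \<and> I \<subseteq> (\<lambda>d. d \<otimes> p) ` D"
proof (rule ccontr)
  assume no: "\<not> ?thesis"
  interpret R: domain DD by (rule DD_domain)
  have ID: "I \<subseteq> D" "submod I" "I \<noteq> {\<zero>}" using I integral_t_ideal_iff by auto
  have pe: "prime_elements DD \<subseteq> D - {\<zero>}" by (auto simp: ring_prime_def)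
  have cl: "a \<in> D" "a \<noteq> \<zero>" if "a \<in> products_of DD (prime_elements DD)" for a
    using R.products_of_closed[of "prime_elements DD" a] pe that by simp_all
  \<comment> \<open>\<open>T\<close> acts as a finite set coprime to \<open>x\<close>: if
    \<open>x\<close> divides \<open>c \<otimes> y\<close> for all \<open>y \<in> T\<close>, then it
    divides \<open>c\<close>. For a product, \<open>a\<close> is cancelled first by its own set,
    then \<open>b\<close>.\<close>
  have key: "\<exists>T. finite T \<and> T \<subseteq> I \<and> (\<forall>c\<in>D. (\<forall>y\<in>T. c \<otimes> y \<otimes> inv x \<in> D) \<longrightarrow> c \<otimes> inv x \<in> D)"
    if "x \<in> products_of DD (prime_elements DD)" for x
    using that
  proof induct
    case (unit u)
    then have "inv u \<in> D" using subring_Units_iff[OF D_subring] by blast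
    then show ?case by (intro exI[of _ "{}"]) auto
  next
    case (gen p)
    then have p: "p \<in> D" "ring_prime\<^bsub>DD\<^esub> p" by auto
    then have p': "p \<in> carrier K" "p \<noteq> \<zero>" using pe by auto
    obtain y where y: "y \<in> I" "y \<notin> (\<lambda>d. d \<otimes> p) ` D" using no p by blast
    then have "y \<in> D" "y \<otimes> inv p \<notin> D" using principal_iff[OF p'] ID by auto
    then have "\<forall>c\<in>D. c \<otimes> y \<otimes> inv p \<in> D \<longrightarrow> c \<otimes> inv p \<in> D"
      using p(2) unfolding DD_ring_prime_iff[OF p(1)] by blast
    then show ?case using y by (intro exI[of _ "{y}"]) auto
  next
    case (mult a b)
    obtain T where T: "finite T" "T \<subseteq> I"
      "\<forall>c\<in>D. (\<forall>y\<in>T. c \<otimes> y \<otimes> inv a \<in> D) \<longrightarrow> c \<otimes> inv a \<in> D" using mult(2) by auto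
    obtain U where U: "finite U" "U \<subseteq> I"
      "\<forall>c\<in>D. (\<forall>y\<in>U. c \<otimes> y \<otimes> inv b \<in> D) \<longrightarrow> c \<otimes> inv b \<in> D" using mult(4) by auto
    have a: "a \<in> carrier K" "a \<noteq> \<zero>" and b: "b \<in> carrier K" "b \<noteq> \<zero>" "b \<in> D"
      using cl[OF mult(1)] cl[OF mult(3)] by auto
    note i = field_inv[OF a] field_inv[OF b(1,2)]
    have "c \<otimes> inv (a \<otimes> b) \<in> D"
      if c: "c \<in> D" and h: "\<forall>y\<in>T \<union> U. c \<otimes> y \<otimes> inv (a \<otimes> b) \<in> D" for c
    proof -
      have "c \<otimes> y \<otimes> inv a \<in> D" if "y \<in> T" for y
      proof -
        have yK: "y \<in> carrier K" using that T ID by auto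
        have "c \<otimes> y \<otimes> inv (a \<otimes> b) \<otimes> b \<in> D" using h that b(3) by blast
        moreover have "c \<otimes> y \<otimes> inv (a \<otimes> b) \<otimes> b = c \<otimes> y \<otimes> inv a \<otimes> (inv b \<otimes> b)"
          using a b c yK i(1,5) by (simp add: inv_mult m_assoc)
        ultimately show ?thesis using i(1,7) yK c by simp
      qed
      then have ca: "c \<otimes> inv a \<in> D" using T(3) c by blast
      have "c \<otimes> inv a \<otimes> y \<otimes> inv b \<in> D" if "y \<in> U" for y
      proof -
        have yK: "y \<in> carrier K" using that U ID by auto
        have "c \<otimes> inv a \<otimes> y \<otimes> inv b = c \<otimes> y \<otimes> inv (a \<otimes> b)"
          using a b c yK i(1,5) by (simp add: inv_mult m_ac)
        then show ?thesis using h that by simp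
      qed
      then have "c \<otimes> inv a \<otimes> inv b \<in> D" using U(3) ca by blast
      then show ?thesis using a b c i(1,5) by (simp add: inv_mult m_assoc)
    qed
    then show ?case using T U by (intro exI[of _ "T \<union> U"]) auto
  qed
  obtain x where x: "x \<in> I" "x \<noteq> \<zero>" using ID submodD(2) by blast
  then have xD: "x \<in> D" using ID by auto
  have "x \<in> products_of DD (prime_elements DD)"
    using R.factorial_monoid_products_of fact x xD
    unfolding factorial_domain_def by auto
  from key[OF this] obtain T where T: "finite T" "T \<subseteq> I"
    "\<forall>c\<in>D. (\<forall>y\<in>T. c \<otimes> y \<otimes> inv x \<in> D) \<longrightarrow> c \<otimes> inv x \<in> D" by auto
  \<comment> \<open>For \<open>z\<close> in the inverse, \<open>key\<close> is applied to
    \<open>c = z \<otimes> x\<close>: \<open>x\<close> divides each \<open>c \<otimes> y\<close>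
    with quotient \<open>z \<otimes> y \<in> D\<close>, so it divides \<open>c\<close>, which means
    \<open>z \<in> D\<close>.\<close>
  have "Inv (insert x T) \<subseteq> D"
  proof
    fix z assume z: "z \<in> Inv (insert x T)"
    then have zK: "z \<in> carrier K" and zx: "z \<otimes> x \<in> D" by (auto simp: Inv_iff)
    have i: "inv x \<in> carrier K" "x \<otimes> inv x = \<one>" using field_inv[of x] x xD by auto
    have "z \<otimes> x \<otimes> y \<otimes> inv x \<in> D" if "y \<in> T" for y
    proof -
      have yK: "y \<in> carrier K" using that T ID by auto
      have "z \<otimes> x \<otimes> y \<otimes> inv x = z \<otimes> y \<otimes> (x \<otimes> inv x)"
        using zK yK i(1) xD by (simp add: m_ac)
      then show ?thesis using z that i zK yK by (simp add: Inv_iff)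
    qed
    then have "z \<otimes> x \<otimes> inv x \<in> D" using T(3) zx by blast
    then show "z \<in> D" using zK i xD by (simp add: m_assoc)
  qed
  then have "I = D" using t_ideal_eq_D[OF I(1), of "insert x T"] T x by auto
  then show False using I by simp
qed

lemma prime_dominated_principal:
  assumes "p \<in> D" "ring_prime\<^bsub>DD\<^esub> p"
  shows "(\<lambda>d. d \<otimes> p) ` D \<in> proper_t_ideals K D" "proper_nonzero_principal K D ((\<lambda>d. d \<otimes> p) ` D)"
proof -
  have p: "p \<noteq> \<zero>" "inv p \<notin> D" using assms DD_ring_prime_iff by auto
  then have "inv p \<in> carrier K" using field_inv assms by auto
  then have "\<one> \<notin> (\<lambda>d. d \<otimes> p) ` D" using principal_iff[of p \<one>] p assms by auto
  then have neq: "(\<lambda>d. d \<otimes> p) ` D \<noteq> D" by (metis D_closed(3))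
  note inv = principal_invertible[OF assms(1) p(1)]
  show "(\<lambda>d. d \<otimes> p) ` D \<in> proper_t_ideals K D"
    using neq invertible_t_ideal[OF inv] by (simp add: proper_t_ideals_iff)
  show "proper_nonzero_principal K D ((\<lambda>d. d \<otimes> p) ` D)"
    unfolding proper_nonzero_principal_def
    using neq principalideal_iff assms(1) invertible_nonzero[OF inv] by blast
qed

lemma factorial_imp_dominated:
  assumes "factorial_domain DD"
  shows "proper_t_ideals K D \<lhd>\<^sub>P proper_nonzero_principal K D"
  unfolding dominated_by_def
proof
  fix I assume "I \<in> proper_t_ideals K D"
  then obtain p where p: "p \<in> D" "ring_prime\<^bsub>DD\<^esub> p" "I \<subseteq> (\<lambda>d. d \<otimes> p) ` D"
    using factorial_t_ideal_subset_prime[OF assms] unfolding proper_t_ideals_iff by blast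
  from p(3) prime_dominated_principal[OF p(1,2)]
  show "\<exists>\<gamma>\<in>proper_t_ideals K D. I \<subseteq> \<gamma> \<and> proper_nonzero_principal K D \<gamma>" by blast
qed

section \<open>In a Krull domain, proper t-ideals lie in height-one primes, which are invertible in
  the locally factorial case\<close>

lemma height_oneD:
  assumes "P \<in> height_one_primes K D"
  shows "primeideal P DD" "P \<noteq> {\<zero>}"
    "\<And>Q. \<lbrakk>primeideal Q DD; Q \<noteq> {\<zero>}; Q \<subseteq> P\<rbrakk> \<Longrightarrow> Q = P"
  using assms unfolding height_one_primes_def by auto

lemma krullD:
  assumes "krull_domain K D"
  shows "\<And>x. \<lbrakk>x \<in> carrier K; \<And>P. P \<in> height_one_primes K D \<Longrightarrow> x \<in> loc P\<rbrakk> \<Longrightarrow> x \<in> D"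
    "\<And>P. P \<in> height_one_primes K D \<Longrightarrow> discrete_valuation_ring (K\<lparr>carrier := loc P\<rparr>)"
    "\<And>x. \<lbrakk>x \<in> D; x \<noteq> \<zero>\<rbrakk> \<Longrightarrow> finite {P \<in> height_one_primes K D. x \<in> P}"
proof -
  have eq: "D = {x \<in> carrier K. \<forall>P\<in>height_one_primes K D. x \<in> loc P}"
    using assms unfolding krull_domain_def by blast
  show "x \<in> D" if "x \<in> carrier K" "\<And>P. P \<in> height_one_primes K D \<Longrightarrow> x \<in> loc P" for x
    by (subst eq) (use that in blast)
qed (use assms in \<open>auto simp: krull_domain_def\<close>)

text \<open>A nonzero \<open>x \<in> I\<close> with one avoiding element for each of the finitely
  many height-one primes over \<open>x\<close> forms a finite set contained in no height-one prime.
  Its inverse then lies in every localization at such a prime, hence in \<open>D\<close>.\<close>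

lemma krull_t_ideal_subset:
  assumes krull: "krull_domain K D" and I: "integral_t_ideal K D I" "I \<noteq> D"
  shows "\<exists>P\<in>height_one_primes K D. I \<subseteq> P"
proof (rule ccontr)
  assume "\<not> ?thesis"
  then have "\<forall>P\<in>height_one_primes K D. \<exists>y. y \<in> I \<and> y \<notin> P" by blast
  then obtain y where y: "\<And>P. P \<in> height_one_primes K D \<Longrightarrow> y P \<in> I \<and> y P \<notin> P" by metis
  have ID: "I \<subseteq> D" "submod I" "I \<noteq> {\<zero>}" using I integral_t_ideal_iff by auto
  then obtain x where x: "x \<in> I" "x \<noteq> \<zero>" "x \<in> D" using submodD(2) by blast
  let ?F = "{P \<in> height_one_primes K D. x \<in> P}"
  have "Inv (insert x (y ` ?F)) \<subseteq> D"
  proof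
    fix z assume z: "z \<in> Inv (insert x (y ` ?F))"
    show "z \<in> D"
    proof (rule krullD(1)[OF krull])
      show "z \<in> carrier K" using z by (simp add: Inv_iff)
    next
      fix P assume P: "P \<in> height_one_primes K D"
      \<comment> \<open>A member of the finite set that avoids \<open>P\<close>, serving as
        denominator of \<open>z\<close>.\<close>
      define s where "s = (if x \<in> P then y P else x)"
      have s: "s \<in> D" "s \<notin> P" using y[OF P] ID x by (auto simp: s_def)
      have "s \<in> insert x (y ` ?F)" using P by (auto simp: s_def)
      then have "z \<otimes> s \<in> D" "z \<in> carrier K" using z unfolding Inv_iff by blast+
      then show "z \<in> loc P"
        using s m_comm[of z s] by (intro locI[OF height_oneD(1)[OF P], of z s]) auto
    qed
  qed
  moreover have "finite (insert x (y ` ?F))" using krullD(3)[OF krull] x by simp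
  ultimately have "I = D" using t_ideal_eq_D[OF I(1), of "insert x (y ` ?F)"] y x by blast
  then show False using I by simp
qed

text \<open>The element \<open>s\<close> has positive value, so its powers exceed the value of
  \<open>x\<close>. In place of a valuation the factorization of \<open>x\<close> is used: exponent
  0 for units, 1 for primes since each of them divides the nonunit \<open>s\<close>, and exponents
  add for products.\<close>

lemma discrete_valuation_power:
  assumes Q: "primeideal Q DD" and dvr: "discrete_valuation_ring (K\<lparr>carrier := loc Q\<rparr>)"
    and s: "s \<in> Q" "s \<noteq> \<zero>" and x: "x \<in> loc Q" "x \<noteq> \<zero>"
  shows "\<exists>n::nat. s [^] n \<otimes> inv x \<in> loc Q"
proof -
  let ?V = "K\<lparr>carrier := loc Q\<rparr>"
  interpret V: principal_domain ?V using dvr unfolding discrete_valuation_ring_def by blast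
  have sD: "s \<in> D" "s \<in> carrier K" using s primeD(1)[OF Q] by auto
  have "inv s \<notin> loc Q"
  proof
    assume "inv s \<in> loc Q"
    then obtain r where r: "r \<in> D" "r \<notin> Q" "r \<otimes> inv s \<in> D" by (rule locE[OF Q])
    then have "r \<otimes> inv s \<otimes> s \<in> Q" using s submodD(4)[OF primeD(2)[OF Q]] by blast
    then show False using r sD s field_inv[of s] by (simp add: m_assoc)
  qed
  then have nonunit: "s \<notin> Units ?V" using loc_Units_iff[OF Q] by blast
  have sV: "s \<in> loc Q" by (rule D_loc[OF Q sD(1)])
  have pow: "s [^] (n::nat) \<in> loc Q" for n
    by (induct n) (use sV loc_closed(2)[OF Q] D_loc[OF Q] in auto)
  have pe: "prime_elements ?V \<subseteq> carrier ?V - {\<zero>\<^bsub>?V\<^esub>}" by (auto simp: ring_prime_def)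
  have "x \<in> products_of ?V (prime_elements ?V)"
    using V.factorial_monoid_products_of V.mult_of.factorial_monoid_axioms x by auto
  then show ?thesis
  proof induct
    case (unit u)
    then have "s [^] (0::nat) \<otimes> inv u \<in> loc Q"
      using loc_Units_iff[OF Q] loc_closed(1)[OF Q] by auto
    then show ?case ..
  next
    case (gen p)
    then have p: "p \<in> loc Q" "p \<noteq> \<zero>" "ring_prime\<^bsub>?V\<^esub> p" using pe by auto
    have "p divides\<^bsub>?V\<^esub> s"
      using discrete_valuation_ring_prime_divides[OF dvr _ p(3) _ nonunit] p sV by simp
    then have "s \<otimes> inv p \<in> loc Q" using subring_divides_iff[OF loc_subring[OF Q] p(1,2) sV] by simp
    then have "s [^] (1::nat) \<otimes> inv p \<in> loc Q" using sD by simp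
    then show ?case ..
  next
    case (mult a b)
    then obtain m n :: nat where mn: "s [^] m \<otimes> inv a \<in> loc Q" "s [^] n \<otimes> inv b \<in> loc Q" by blast
    have ab: "a \<in> loc Q" "a \<noteq> \<zero>" "b \<in> loc Q" "b \<noteq> \<zero>"
      using V.products_of_closed[OF pe] mult by auto
    then have c: "a \<in> carrier K" "b \<in> carrier K" using loc_closed(1)[OF Q] by auto
    have "(s [^] m \<otimes> inv a) \<otimes> (s [^] n \<otimes> inv b) \<in> loc Q" using mn loc_closed(2)[OF Q] by blast
    moreover have "(s [^] m \<otimes> inv a) \<otimes> (s [^] n \<otimes> inv b) = (s [^] m \<otimes> s [^] n) \<otimes> inv (a \<otimes> b)"
      using ab c sD field_inv(1)[of a] field_inv(1)[of b] by (simp add: inv_mult m_ac)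
    ultimately have "s [^] (m + n) \<otimes> inv (a \<otimes> b) \<in> loc Q" using sD by (simp add: nat_pow_mult)
    then show ?case by auto
  qed
qed

lemma prime_pow_notin:
  assumes "primeideal M DD" "s \<in> D" "s \<notin> M"
  shows "s [^] (n::nat) \<in> D \<and> s [^] n \<notin> M"
proof (induct n)
  case 0
  then show ?case using primeD(3)[OF assms(1)] by simp
next
  case (Suc n)
  then show ?case using primeD(5)[OF assms(1), of "s [^] n" s] assms by auto
qed

text \<open>Kaplansky's argument: a nonzero element of \<open>P\<close> is a product of primes of
  \<open>loc M\<close>, and primality of \<open>P\<close> selects one of the factors.\<close>

lemma exists_prime_element_in:
  assumes M: "primeideal M DD" and fact: "factorial_domain (K\<lparr>carrier := loc M\<rparr>)"
    and P: "primeideal P DD" "P \<noteq> {\<zero>}" "P \<subseteq> M"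
  shows "\<exists>p\<in>P. ring_prime\<^bsub>K\<lparr>carrier := loc M\<rparr>\<^esub> p"
proof -
  let ?V = "K\<lparr>carrier := loc M\<rparr>"
  interpret V: domain ?V by (rule loc_domain[OF M])
  have pe: "prime_elements ?V \<subseteq> carrier ?V - {\<zero>\<^bsub>?V\<^esub>}" by (auto simp: ring_prime_def)
  \<comment> \<open>The factors lie in \<open>loc M\<close> rather than \<open>D\<close>, so the
    induction permits a multiplier \<open>s\<close> outside \<open>M\<close>. It is a unit of
    \<open>loc M\<close>, so \<open>s \<otimes> p\<close> is still prime, and it is outside
    \<open>P\<close>, so it can be cancelled there.\<close>
  have ex: "\<exists>p\<in>P. ring_prime\<^bsub>?V\<^esub> p"
    if "x \<in> products_of ?V (prime_elements ?V)" "\<exists>s\<in>D - M. s \<otimes> x \<in> P" for x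
    using that
  proof induct
    case (unit u)
    then have u: "u \<in> loc M" "u \<noteq> \<zero>" "inv u \<in> loc M" using loc_Units_iff[OF M] by auto
    obtain s where s: "s \<in> D" "s \<notin> M" "s \<otimes> u \<in> P" using unit by auto
    obtain t where t: "t \<in> D" "t \<notin> M" "t \<otimes> inv u \<in> D" by (rule locE[OF M u(3)])
    have uK: "u \<in> carrier K" using loc_closed(1)[OF M u(1)] .
    have "(t \<otimes> inv u) \<otimes> (s \<otimes> u) \<in> P" using submodD(4)[OF primeD(2)[OF P(1)]] s t by blast
    moreover have "(t \<otimes> inv u) \<otimes> (s \<otimes> u) = t \<otimes> s \<otimes> (inv u \<otimes> u)"
      using s t uK field_inv(1)[of u] u(2) by (simp add: m_ac)
    ultimately have "t \<otimes> s \<in> M" using P(3) s t field_inv[of u] uK u(2) by auto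
    then show ?case using primeD(5)[OF M t(1) s(1)] s t by blast
  next
    case (gen p)
    then have p: "p \<in> loc M" "ring_prime\<^bsub>?V\<^esub> p" by auto
    obtain s where s: "s \<in> D" "s \<notin> M" "s \<otimes> p \<in> P" using gen by auto
    have s0: "s \<noteq> \<zero>" using s primeD(4)[OF M] by auto
    have pK: "p \<in> carrier K" "p \<noteq> \<zero>" using loc_closed(1)[OF M p(1)] p by (auto simp: ring_prime_def)
    have sU: "s \<in> Units ?V" using loc_Units_iff[OF M] D_loc[OF M] inv_loc[OF M] s s0 by blast
    have as: "s \<otimes> p \<in> loc M" using loc_closed(2)[OF M] D_loc[OF M] s p by blast
    have a1: "p \<sim>\<^bsub>?V\<^esub> s \<otimes> p"
      using V.ring_associated_iff[of "s \<otimes> p" p] as p(1) sU V.associated_sym by auto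
    have "prime (mult_of ?V) p" using V.ring_primeE(2) p by auto
    moreover have "p \<sim>\<^bsub>mult_of ?V\<^esub> s \<otimes> p"
      using a1 V.assoc_iff_assoc_mult[of p "s \<otimes> p"] p as by auto
    moreover have nz: "s \<otimes> p \<noteq> \<zero>" using s s0 pK by (simp add: integral_iff)
    ultimately have "prime (mult_of ?V) (s \<otimes> p)"
      using V.mult_of.prime_cong[of p "s \<otimes> p"] p as pK by auto
    then have "ring_prime\<^bsub>?V\<^esub> (s \<otimes> p)" using V.ring_primeI'[of "s \<otimes> p"] as nz by auto
    then show ?case using s by blast
  next
    case (mult a b)
    then obtain s where s: "s \<in> D" "s \<notin> M" "s \<otimes> (a \<otimes> b) \<in> P" by auto
    have ab: "a \<in> loc M" "b \<in> loc M" using V.products_of_closed[OF pe] mult by auto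
    obtain t where t: "t \<in> D" "t \<notin> M" "t \<otimes> a \<in> D" "a \<in> carrier K" by (rule locE[OF M ab(1)])
    obtain r where r: "r \<in> D" "r \<notin> M" "r \<otimes> b \<in> D" "b \<in> carrier K" by (rule locE[OF M ab(2)])
    have "(t \<otimes> r) \<otimes> (s \<otimes> (a \<otimes> b)) \<in> P" using submodD(4)[OF primeD(2)[OF P(1)]] s t r by blast
    moreover have "(t \<otimes> r) \<otimes> (s \<otimes> (a \<otimes> b)) = s \<otimes> ((t \<otimes> a) \<otimes> (r \<otimes> b))"
      using s t r by (simp add: m_ac)
    ultimately have "s \<otimes> ((t \<otimes> a) \<otimes> (r \<otimes> b)) \<in> P" by simp
    then have "(t \<otimes> a) \<otimes> (r \<otimes> b) \<in> P"
      using primeD(5)[OF P(1) s(1), of "(t \<otimes> a) \<otimes> (r \<otimes> b)"] s P(3) t r by auto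
    then have "t \<otimes> a \<in> P \<or> r \<otimes> b \<in> P" using primeD(5)[OF P(1)] t r by blast
    then show ?case using mult t r by blast
  qed
  obtain x where x: "x \<in> P" "x \<noteq> \<zero>" using P primeD(4)[OF P(1)] by blast
  then have xD: "x \<in> D" using primeD(1)[OF P(1)] by auto
  have "x \<in> products_of ?V (prime_elements ?V)"
    using V.factorial_monoid_products_of fact x D_loc[OF M xD]
    unfolding factorial_domain_def by auto
  moreover have "\<exists>s\<in>D - M. s \<otimes> x \<in> P"
    using primeD(3)[OF M] x xD by (intro bexI[of _ \<one>]) auto
  ultimately show ?thesis by (rule ex)
qed

text \<open>The product of the individual multipliers works: further factors from \<open>D\<close>
  do not leave \<open>loc Q\<close>, and primality of \<open>M\<close> keeps the product outside
  \<open>M\<close>.\<close>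

lemma common_multiplier:
  assumes M: "primeideal M DD" and "finite F"
    and "\<And>Q. Q \<in> F \<Longrightarrow> primeideal Q DD \<and> (\<exists>s\<in>D - M. s \<otimes> w \<in> loc Q)" and w: "w \<in> carrier K"
  shows "\<exists>s\<in>D - M. \<forall>Q\<in>F. s \<otimes> w \<in> loc Q"
  using assms(2,3)
proof (induct F)
  case empty
  then show ?case using primeD(3)[OF M] by auto
next
  case (insert Q F)
  then obtain s t where s: "s \<in> D" "s \<notin> M" "\<forall>Q\<in>F. s \<otimes> w \<in> loc Q"
    and t: "t \<in> D" "t \<notin> M" "t \<otimes> w \<in> loc Q" by (metis DiffE insertCI)
  have "s \<otimes> t \<in> D - M" using s t primeD(5)[OF M] by auto
  moreover have "(s \<otimes> t) \<otimes> w \<in> loc Q'" if "Q' \<in> insert Q F" for Q'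
  proof -
    have Q': "primeideal Q' DD" using insert that by blast
    have "t \<otimes> w \<in> loc Q' \<or> s \<otimes> w \<in> loc Q'" using that s t by auto
    then consider "t \<otimes> w \<in> loc Q'" | "s \<otimes> w \<in> loc Q'" by blast
    then show ?thesis
    proof cases
      case 1
      then have "s \<otimes> (t \<otimes> w) \<in> loc Q'" using loc_closed(2)[OF Q'] D_loc[OF Q'] s by blast
      then show ?thesis using s t w by (simp add: m_assoc)
    next
      case 2
      then have "t \<otimes> (s \<otimes> w) \<in> loc Q'" using loc_closed(2)[OF Q'] D_loc[OF Q'] t by blast
      moreover have "t \<otimes> (s \<otimes> w) = s \<otimes> t \<otimes> w" using s t w by (simp add: m_ac)
      ultimately show ?thesis by simp
    qed
  qed
  ultimately show ?case by blast
qed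

text \<open>
  If \<open>P P\<^sup>-\<^sup>1\<close> lay in a maximal ideal \<open>M\<close>, then \<open>P D\<^sub>M = p D\<^sub>M\<close> for a prime element \<open>p \<in> P\<close>, and
  the finitely many other height-one primes containing \<open>p\<close> can be cancelled by some
  \<open>s \<notin> M\<close>, so that \<open>s/p \<in> P\<^sup>-\<^sup>1\<close> and \<open>s = p (s/p) \<in> M\<close>.
\<close>
lemma krull_height_one_invertible:
  assumes krull: "krull_domain K D" and lf: "locally_factorial K D" and P: "P \<in> height_one_primes K D"
  shows "invertible P"
proof (rule ccontr)
  assume ninv: "\<not> invertible P"
  note P' = height_oneD[OF P]
  have Psub: "submod P" "P \<subseteq> D" using primeD[OF P'(1)] by auto
  let ?E = "ideal_prod K P (Inv P)"
  have sE: "submod ?E" using Psub by (intro ideal_prod_submod Inv_submod) auto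
  have "ideal ?E DD" using sE ideal_prod_Inv[OF Psub(1)] by (simp add: ideal_iff)
  moreover have "\<one> \<notin> ?E" using ninv Psub unfolding invertible_def by blast
  then have "?E \<noteq> carrier DD" using D_closed(3) by auto
  ultimately obtain M where maxM: "maximalideal M DD" "?E \<subseteq> M"
    using ring.exists_maximalideal[OF subring_is_ring[OF D_subring]] by blast
  have M: "primeideal M DD" by (rule maximalideal_primeideal[OF maxM(1)])
  have one: "\<one> \<in> Inv P" using Psub by (auto simp: Inv_iff)
  have "P \<subseteq> M"
  proof
    fix x assume x: "x \<in> P"
    then have "x \<otimes> \<one> \<in> ?E" using one by (intro ideal_prod.prod)
    then show "x \<in> M" using maxM(2) x submodD(1)[OF Psub(1)] by auto
  qed
  have fact: "factorial_domain (K\<lparr>carrier := loc M\<rparr>)" using lf maxM unfolding locally_factorial_def by blast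
  obtain p where p: "p \<in> P" "ring_prime\<^bsub>K\<lparr>carrier := loc M\<rparr>\<^esub> p"
    using exists_prime_element_in[OF M fact P'(1,2) \<open>P \<subseteq> M\<close>] by blast
  have pD: "p \<in> D" "p \<in> carrier K" "p \<in> loc M" using p Psub D_loc[OF M] by auto
  have pp: "p \<noteq> \<zero>" "inv p \<notin> loc M"
    "\<And>a b. \<lbrakk>a \<in> loc M; b \<in> loc M; a \<otimes> b \<otimes> inv p \<in> loc M\<rbrakk> \<Longrightarrow> a \<otimes> inv p \<in> loc M \<or> b \<otimes> inv p \<in> loc M"
    using p(2) unfolding subring_ring_prime_iff[OF loc_subring[OF M] pD(3)] by blast+
  have i: "inv p \<in> carrier K" "p \<otimes> inv p = \<one>" "inv p \<otimes> p = \<one>" using field_inv pD pp by auto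
  \<comment> \<open>Every prime inside \<open>M\<close> that contains \<open>p\<close> contains all
    elements of \<open>D\<close> divisible by \<open>p\<close> in \<open>loc M\<close>.\<close>
  have contract: "y \<in> Q" if h: "y \<in> D" "y \<otimes> inv p \<in> loc M" "primeideal Q DD" "p \<in> Q" "Q \<subseteq> M" for y Q
  proof -
    obtain r where r: "r \<in> D" "r \<notin> M" "r \<otimes> (y \<otimes> inv p) \<in> D" by (rule locE[OF M h(2)])
    have "r \<otimes> (y \<otimes> inv p) \<otimes> p \<in> Q" using submodD(4)[OF primeD(2)[OF h(3)]] r h(4) by blast
    moreover have "r \<otimes> (y \<otimes> inv p) \<otimes> p = r \<otimes> y \<otimes> (inv p \<otimes> p)"
      using r h(1) i(1) pD by (simp add: m_assoc)
    ultimately have "r \<otimes> y \<in> Q" using i r h(1) by simp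
    then show ?thesis using primeD(5)[OF h(3) r(1) h(1)] r h(5) by blast
  qed
  \<comment> \<open>The contraction to \<open>D\<close> of the ideal generated by \<open>p\<close>
    in \<open>loc M\<close>: a nonzero prime inside \<open>P\<close>, so equal to \<open>P\<close>
    by height one. This shows that \<open>p\<close> generates \<open>P\<close> locally at
    \<open>M\<close>.\<close>
  define Q0 where "Q0 = {y \<in> D. y \<otimes> inv p \<in> loc M}"
  have "primeideal Q0 DD"
    unfolding primeideal_iff
  proof (intro conjI ballI impI)
    show "submod Q0" unfolding submod_iff
    proof (intro conjI ballI)
      show "\<zero> \<in> Q0" using i D_loc[OF M] by (simp add: Q0_def)
    next
      fix x y assume "x \<in> Q0" "y \<in> Q0"
      then show "x \<oplus> y \<in> Q0" using i(1) loc_closed(3)[OF M] by (simp add: Q0_def l_distr)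
    next
      fix d x assume "d \<in> D" "x \<in> Q0"
      then show "d \<otimes> x \<in> Q0" using i(1) loc_closed(2)[OF M] D_loc[OF M] by (simp add: Q0_def m_assoc)
    qed (auto simp: Q0_def)
    show "\<one> \<notin> Q0" using pp(2) i by (simp add: Q0_def)
    fix a b assume "a \<in> D" "b \<in> D" "a \<otimes> b \<in> Q0"
    then show "a \<in> Q0 \<or> b \<in> Q0" using pp(3)[of a b] D_loc[OF M] by (simp add: Q0_def)
  qed (auto simp: Q0_def)
  moreover have "p \<in> Q0" using pD i D_loc[OF M] by (simp add: Q0_def)
  then have "Q0 \<noteq> {\<zero>}" using pp by auto
  moreover have "Q0 \<subseteq> P" using contract[OF _ _ P'(1) p(1) \<open>P \<subseteq> M\<close>] by (auto simp: Q0_def)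
  ultimately have "Q0 = P" by (rule P'(3))
  then have div: "y \<otimes> inv p \<in> loc M" if "y \<in> P" for y using that by (auto simp: Q0_def)
  let ?F = "{Q \<in> height_one_primes K D. p \<in> Q} - {P}"
  have "\<exists>s\<in>D - M. s \<otimes> inv p \<in> loc Q" if "Q \<in> ?F" for Q
  proof -
    have Q: "Q \<in> height_one_primes K D" "p \<in> Q" "Q \<noteq> P" using that by auto
    note Q' = height_oneD[OF Q(1)]
    \<comment> \<open>Inside \<open>M\<close>, the prime \<open>Q\<close> would contain
      \<open>P\<close> by \<open>contract\<close>, against its height being one.\<close>
    have "\<not> Q \<subseteq> M"
    proof
      assume "Q \<subseteq> M"
      then have "P \<subseteq> Q" using contract[OF _ div Q'(1) Q(2)] Psub by blast
      then show False using Q'(3)[OF P'(1,2)] Q by simp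
    qed
    then obtain s where s: "s \<in> Q" "s \<notin> M" by blast
    then have sD: "s \<in> D" "s \<noteq> \<zero>" using primeD(1)[OF Q'(1)] primeD(4)[OF M] by auto
    obtain n :: nat where "s [^] n \<otimes> inv p \<in> loc Q"
      using discrete_valuation_power[OF Q'(1) krullD(2)[OF krull Q(1)] s(1) sD(2) D_loc[OF Q'(1) pD(1)] pp(1)]
      by blast
    then show ?thesis using prime_pow_notin[OF M sD(1) s(2), of n] by blast
  qed
  then obtain s where s: "s \<in> D" "s \<notin> M" "\<forall>Q\<in>?F. s \<otimes> inv p \<in> loc Q"
    using common_multiplier[OF M, of ?F "inv p"] krullD(3)[OF krull pD(1) pp(1)] height_oneD(1) i(1)
    by auto
  have "s \<otimes> inv p \<in> Inv P" unfolding Inv_iff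
  proof (intro conjI ballI)
    show "s \<otimes> inv p \<in> carrier K" using s i by auto
    fix y assume y: "y \<in> P"
    then have yD: "y \<in> D" using Psub by auto
    show "s \<otimes> inv p \<otimes> y \<in> D"
    proof (rule krullD(1)[OF krull])
      show "s \<otimes> inv p \<otimes> y \<in> carrier K" using s i yD by auto
      fix Q assume Q: "Q \<in> height_one_primes K D"
      note Q' = height_oneD[OF Q]
      note cl = loc_closed(2)[OF Q'(1)]
      note dl = D_loc[OF Q'(1)]
      \<comment> \<open>At \<open>P\<close> the quotient \<open>y \<otimes> inv p\<close> already
        lies in \<open>loc M\<close>; at the other primes over \<open>p\<close> the factor
        \<open>s\<close> compensates; elsewhere \<open>p\<close> is a unit.\<close>
      consider "Q = P" | "Q \<in> ?F" | "p \<notin> Q" using Q by blast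
      then show "s \<otimes> inv p \<otimes> y \<in> loc Q"
      proof cases
        case 1
        have "y \<otimes> inv p \<in> loc Q" using div[OF y] loc_mono[OF M P'(1) \<open>P \<subseteq> M\<close>] 1 by blast
        then have "s \<otimes> (y \<otimes> inv p) \<in> loc Q" using cl dl s by blast
        moreover have "s \<otimes> (y \<otimes> inv p) = s \<otimes> inv p \<otimes> y" using s yD i(1) by (simp add: m_ac)
        ultimately show ?thesis by simp
      next
        case 2
        then show ?thesis using s(3) cl dl yD by blast
      next
        case 3
        then show ?thesis using inv_loc[OF Q'(1) pD(1)] cl dl yD s by blast
      qed
    qed
  qed
  then have "p \<otimes> (s \<otimes> inv p) \<in> ?E" using p by (intro ideal_prod.prod)
  moreover have "p \<otimes> (s \<otimes> inv p) = s" using m_lcomm[of p s "inv p"] pD s i by simp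
  ultimately show False using maxM s by auto
qed

lemma krull_imp_dominated:
  assumes "krull_domain K D" "locally_factorial K D"
  shows "proper_t_ideals K D \<lhd>\<^sub>P proper_invertible K D"
  unfolding dominated_by_def
proof
  fix I assume "I \<in> proper_t_ideals K D"
  then obtain P where P: "P \<in> height_one_primes K D" "I \<subseteq> P"
    using krull_t_ideal_subset[OF assms(1)] unfolding proper_t_ideals_iff by blast
  have "invertible P" by (rule krull_height_one_invertible[OF assms P(1)])
  moreover have "P \<noteq> D" using primeD(3)[OF height_oneD(1)[OF P(1)]] by auto
  ultimately show "\<exists>\<gamma>\<in>proper_t_ideals K D. I \<subseteq> \<gamma> \<and> proper_invertible K D \<gamma>"
    using P invertible_t_ideal by (auto simp: proper_t_ideals_iff proper_invertible_iff)
qed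

end

section \<open>Domains whose t-ideals are dominated by invertible ideals\<close>

text \<open>Domination by invertible ideals is the weaker of the two hypotheses, so the results also
  serve the principal case.\<close>

locale invertibly_dominated = fraction_field +
  assumes acc: "t_ACC_domain K D"
    and dominated: "proper_t_ideals K D \<lhd>\<^sub>P proper_invertible K D"
begin

text \<open>The chain condition as Noetherian induction: a strictly ascending sequence of invertible
  ideals would be one of t-invertible t-ideals.\<close>

lemma invertible_acc_induct [consumes 1, case_names step]:
  assumes "invertible I"
    and step: "\<And>I. \<lbrakk>invertible I; \<And>J. \<lbrakk>invertible J; I \<subset> J\<rbrakk> \<Longrightarrow> P J\<rbrakk> \<Longrightarrow> P I"
  shows "P I"
proof -
  let ?r = "{(J, I). invertible I \<and> invertible J \<and> I \<subset> J}"
  have "wf ?r"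
    unfolding wf_iff_no_infinite_down_chain
  proof
    assume "\<exists>f. \<forall>i. (f (Suc i), f i) \<in> ?r"
    then obtain f :: "nat \<Rightarrow> 'a set" where "\<forall>i. (f (Suc i), f i) \<in> ?r" by blast
    then have f: "\<And>i. invertible (f i)" "\<And>i. f i \<subset> f (Suc i)" by auto
    have 1: "\<forall>n. integral_t_ideal K D (f n) \<and> t_invertible K D (f n)"
      using f(1) invertible_t_ideal invertible_t_invertible by blast
    have 2: "\<forall>n. f n \<subseteq> f (Suc n)" using f(2) by blast
    from acc[unfolded t_ACC_domain_def, THEN spec[of _ f], THEN mp, OF 1, THEN mp, OF 2]
    obtain n where n: "\<forall>m\<ge>n. f m = f n" ..
    have "f (Suc n) = f n" by (rule n[rule_format]) simp
    then show False using f(2)[of n] by simp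
  qed
  then show ?thesis
    using assms(1)
  proof (induct I rule: wf_induct_rule)
    case (less I)
    show ?case by (rule step[OF less(2)]) (use less in blast)
  qed
qed

section \<open>Maximal proper invertible ideals and height-one primes\<close>

text \<open>Maximality is among proper invertible ideals only; the members need not be maximal
  ideals of \<open>D\<close>. They turn out to be the height-one primes.\<close>

definition max_invertible :: "'a set set" where
  "max_invertible = {A. invertible A \<and> A \<noteq> D \<and> (\<forall>B. invertible B \<longrightarrow> B \<noteq> D \<longrightarrow> A \<subseteq> B \<longrightarrow> B = A)}"

lemma max_invertibleD:
  assumes "A \<in> max_invertible"
  shows "invertible A" "A \<noteq> D" "\<And>B. \<lbrakk>invertible B; B \<noteq> D; A \<subseteq> B\<rbrakk> \<Longrightarrow> B = A"
  using assms unfolding max_invertible_def by auto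

lemma invertible_subset_max:
  assumes "invertible I" "I \<noteq> D"
  shows "\<exists>A\<in>max_invertible. I \<subseteq> A"
  using assms
proof (induct I rule: invertible_acc_induct)
  case (step I)
  show ?case
  proof (cases "I \<in> max_invertible")
    case False
    then obtain B where "invertible B" "B \<noteq> D" "I \<subset> B" using step unfolding max_invertible_def by auto
    then show ?thesis using step(2)[of B] by blast
  qed blast
qed

lemma t_ideal_subset_max:
  assumes "integral_t_ideal K D I" "I \<noteq> D"
  shows "\<exists>A\<in>max_invertible. I \<subseteq> A"
proof -
  have "I \<in> proper_t_ideals K D" using assms by (simp add: proper_t_ideals_iff)
  then obtain B where "I \<subseteq> B" "proper_invertible K D B"
    using dominated unfolding dominated_by_def by blast
  then show ?thesis using invertible_subset_max[of B] unfolding proper_invertible_iff by blast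
qed

text \<open>Let \<open>b \<otimes> c \<in> A\<close> with \<open>b \<notin> A\<close>. The double
  inverse of \<open>insert b A\<close> is a t-ideal; a member of \<open>max_invertible\<close> above
  it would contain \<open>A\<close>, hence equal \<open>A\<close>, and contain \<open>b\<close>. So
  it is \<open>D\<close>, and \<open>Inv (insert b A) = D\<close>. Now \<open>c\<close> multiplies
  \<open>Inv A\<close> into this inverse, so \<open>c\<close> lies in the double inverse of
  \<open>A\<close>, which is \<open>A\<close>.\<close>

lemma max_invertible_prime:
  assumes A: "A \<in> max_invertible"
  shows "primeideal A DD"
  unfolding primeideal_iff
proof (intro conjI ballI impI)
  note A' = max_invertibleD[OF A]
  note I = invertibleD[OF A'(1)]
  show "A \<subseteq> D" "submod A" by (fact I)+
  show "\<one> \<notin> A" using submod_eq_D[OF I(2,1)] A'(2) by blast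
  fix b c assume b: "b \<in> D" and c: "c \<in> D" and bc: "b \<otimes> c \<in> A"
  show "b \<in> A \<or> c \<in> A"
  proof (rule disjCI, rule ccontr)
    assume cA: "c \<notin> A" and bA: "b \<notin> A"
    let ?J = "Inv (Inv (insert b A))"
    have bK: "insert b A \<subseteq> carrier K" using b I(4) by auto
    have sub: "insert b A \<subseteq> ?J" by (rule subset_v[OF bK])
    have "insert b A \<subseteq> D" using b I(1) by simp
    from Inv_antimono[OF Inv_antimono[OF this]] have JD: "?J \<subseteq> D" by (simp add: Inv_D)
    have "?J \<noteq> {\<zero>}" using sub invertible_nonzero[OF A'(1)] submodD(2)[OF I(2)] by blast
    then have t: "integral_t_ideal K D ?J" by (intro Inv_t_ideal Inv_carrier JD)
    have "?J = D"
    proof (rule ccontr)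
      assume "?J \<noteq> D"
      then obtain B where B: "B \<in> max_invertible" "?J \<subseteq> B" using t_ideal_subset_max[OF t] by blast
      then have "B = A" using A'(3) max_invertibleD(1,2)[OF B(1)] sub by blast
      then show False using B sub bA by blast
    qed
    then have "Inv (insert b A) = D" using Inv_v[OF bK] Inv_D by simp
    moreover have "c \<otimes> z \<in> Inv (insert b A)" if z: "z \<in> Inv A" for z
      unfolding Inv_iff
    proof (intro conjI ballI)
      have zK: "z \<in> carrier K" using z by (simp add: Inv_iff)
      then show "c \<otimes> z \<in> carrier K" using c by simp
      fix y assume "y \<in> insert b A"
      then consider "y = b" | "y \<in> A" by blast
      then show "c \<otimes> z \<otimes> y \<in> D"
      proof cases
        case 1
        have "z \<otimes> (b \<otimes> c) \<in> D" using z bc by (simp add: Inv_iff)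
        moreover have "z \<otimes> (b \<otimes> c) = c \<otimes> z \<otimes> b" using zK b c by (simp add: m_ac)
        ultimately show ?thesis using 1 by simp
      next
        case 2
        then have "c \<otimes> (z \<otimes> y) \<in> D" using z c by (simp add: Inv_iff)
        then show ?thesis using zK c 2 I(4) m_assoc[of c z y] by auto
      qed
    qed
    ultimately have "c \<in> Inv (Inv A)" using c unfolding Inv_iff[of c] by auto
    then show False using invertible_v[OF A'(1)] cA by blast
  qed
qed

text \<open>Every invertible ideal is a product of maximal proper invertible ideals.\<close>
lemma invertible_induct:
  assumes "invertible I" and "P D"
    and mult: "\<And>A I. \<lbrakk>A \<in> max_invertible; invertible I; P I\<rbrakk> \<Longrightarrow> P (ideal_prod K A I)"
  shows "P I"
  using assms(1)
proof (induct I rule: invertible_acc_induct)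
  case (step I)
  show ?case
  proof (cases "I = D")
    case False
    then obtain A where A: "A \<in> max_invertible" "I \<subseteq> A" using invertible_subset_max step(1) by blast
    then obtain J where "invertible J" "I \<subset> J" "ideal_prod K A J = I"
      using invertible_quotient[OF step(1) _ A(2)] max_invertibleD[OF A(1)] by blast
    then show ?thesis using mult[OF A(1), of J] step(2)[of J] by simp
  qed (simp add: assms(2))
qed

text \<open>The principal ideal of a nonzero \<open>x \<in> Q\<close> is a product of members of
  \<open>max_invertible\<close>, and the prime \<open>Q\<close> contains one of the factors.\<close>

lemma prime_contains_max:
  assumes Q: "primeideal Q DD" "Q \<noteq> {\<zero>}"
  shows "\<exists>A\<in>max_invertible. A \<subseteq> Q"
proof -
  obtain x where x: "x \<in> Q" "x \<noteq> \<zero>" using Q primeD(4) by blast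
  have xD: "x \<in> D" using x primeD(1)[OF Q(1)] by blast
  have "I \<subseteq> Q \<longrightarrow> (\<exists>A\<in>max_invertible. A \<subseteq> Q)" if "invertible I" for I
    using that
  proof (rule invertible_induct)
    show "D \<subseteq> Q \<longrightarrow> (\<exists>A\<in>max_invertible. A \<subseteq> Q)" using primeD(3)[OF Q(1)] by blast
    fix A I assume A: "A \<in> max_invertible" and I: "invertible I" "I \<subseteq> Q \<longrightarrow> (\<exists>A\<in>max_invertible. A \<subseteq> Q)"
    show "ideal_prod K A I \<subseteq> Q \<longrightarrow> (\<exists>A\<in>max_invertible. A \<subseteq> Q)"
    proof
      assume sub: "ideal_prod K A I \<subseteq> Q"
      have "A \<subseteq> Q \<or> I \<subseteq> Q"
      proof (rule ccontr)
        assume "\<not> (A \<subseteq> Q \<or> I \<subseteq> Q)"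
        then obtain a i where "a \<in> A" "a \<notin> Q" "i \<in> I" "i \<notin> Q" by blast
        moreover from this have "a \<otimes> i \<in> Q" using sub ideal_prod.prod[of a A i I K] by blast
        ultimately show False
          using primeD(5)[OF Q(1), of a i] invertibleD(1)[OF I(1)]
            invertibleD(1)[OF max_invertibleD(1)[OF A]] by blast
      qed
      then show "\<exists>A\<in>max_invertible. A \<subseteq> Q" using A I by blast
    qed
  qed
  moreover have "(\<lambda>d. d \<otimes> x) ` D \<subseteq> Q" by (rule principal_subset[OF primeD(2)[OF Q(1)] x(1)])
  ultimately show ?thesis using principal_invertible[OF xD x(2)] by blast
qed

lemma max_invertible_eq:
  assumes "A \<in> max_invertible" "B \<in> max_invertible" "A \<subseteq> B"
  shows "A = B"
  using max_invertibleD(3)[OF assms(1) max_invertibleD(1,2)[OF assms(2)] assms(3)] by simp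

text \<open>Every nonzero prime contains a member of \<open>max_invertible\<close>, and the members
  are pairwise incomparable primes, so they are exactly the minimal nonzero primes.\<close>

lemma height_one_primes_eq: "height_one_primes K D = max_invertible"
proof (intro equalityI subsetI)
  fix P assume "P \<in> height_one_primes K D"
  then have P: "primeideal P DD" "P \<noteq> {\<zero>}"
    "\<And>Q. primeideal Q DD \<Longrightarrow> Q \<noteq> {\<zero>} \<Longrightarrow> Q \<subseteq> P \<Longrightarrow> Q = P"
    unfolding height_one_primes_def by auto
  obtain A where A: "A \<in> max_invertible" "A \<subseteq> P" using prime_contains_max[OF P(1,2)] by blast
  then have "A = P" by (intro P(3) max_invertible_prime invertible_nonzero max_invertibleD(1))
  then show "P \<in> max_invertible" using A by simp
next
  fix A assume A: "A \<in> max_invertible"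
  have "Q = A" if Q: "primeideal Q DD" "Q \<noteq> {\<zero>}" "Q \<subseteq> A" for Q
  proof -
    obtain B where B: "B \<in> max_invertible" "B \<subseteq> Q" using prime_contains_max[OF Q(1,2)] by blast
    then have "B = A" using max_invertible_eq[OF B(1) A] Q(3) by blast
    then show ?thesis using B Q by blast
  qed
  then show "A \<in> height_one_primes K D"
    using max_invertible_prime[OF A] invertible_nonzero[OF max_invertibleD(1)[OF A]]
    unfolding height_one_primes_def by blast
qed

text \<open>A member above a product of \<open>A\<close> and \<open>I\<close> contains
  \<open>I\<close> or contains \<open>A\<close>, hence equals \<open>A\<close>; each factor thus
  adds at most one member.\<close>

lemma finite_max_invertible:
  assumes "invertible I"
  shows "finite {A \<in> max_invertible. I \<subseteq> A}"
  using assms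
proof (rule invertible_induct)
  have none: "{A \<in> max_invertible. D \<subseteq> A} = {}"
    using primeD(3)[OF max_invertible_prime] by blast
  show "finite {A \<in> max_invertible. D \<subseteq> A}" unfolding none by simp
next
  fix A I assume A: "A \<in> max_invertible" and I: "invertible I" "finite {A \<in> max_invertible. I \<subseteq> A}"
  have "B = A \<or> I \<subseteq> B" if B: "B \<in> max_invertible" "ideal_prod K A I \<subseteq> B" for B
  proof (rule ccontr)
    assume "\<not> ?thesis"
    then have "\<not> A \<subseteq> B" "\<not> I \<subseteq> B" using max_invertible_eq[OF A B(1)] by auto
    then obtain a i where "a \<in> A" "a \<notin> B" "i \<in> I" "i \<notin> B" by blast
    moreover from this have "a \<otimes> i \<in> B" using B ideal_prod.prod[of a A i I K] by blast
    ultimately show False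
      using primeD(5)[OF max_invertible_prime[OF B(1)], of a i] invertibleD(1)[OF I(1)]
        invertibleD(1)[OF max_invertibleD(1)[OF A]] by blast
  qed
  then have "{B \<in> max_invertible. ideal_prod K A I \<subseteq> B} \<subseteq> insert A {A \<in> max_invertible. I \<subseteq> A}"
    by blast
  then show "finite {B \<in> max_invertible. ideal_prod K A I \<subseteq> B}"
    using I finite_subset by blast
qed

section \<open>Localizations are factorial, and discrete valuation rings at height-one
  primes\<close>

text \<open>The primes that suffice for factorization in \<open>loc N\<close>. Members of
  \<open>max_invertible\<close> not inside \<open>N\<close> are left out because their local
  generators are units.\<close>

definition local_gens :: "'a set \<Rightarrow> 'a set" where
  "local_gens N = {f. \<exists>A\<in>max_invertible. A \<subseteq> N \<and> local_gen N A f}"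

lemma local_gens_prime:
  assumes N: "primeideal N DD" and f: "f \<in> local_gens N"
  shows "f \<in> prime_elements (K\<lparr>carrier := loc N\<rparr>)"
proof -
  obtain A where A: "A \<in> max_invertible" "A \<subseteq> N" "local_gen N A f"
    using f unfolding local_gens_def by blast
  then have "f \<in> D" using primeD(1)[OF max_invertible_prime] unfolding local_gen_def by blast
  then show ?thesis
    using local_gen_prime[OF N max_invertible_prime[OF A(1)] A(2,3)] D_loc[OF N] by simp
qed

text \<open>Local generators multiply along the factorization of \<open>I\<close> into members of
  \<open>max_invertible\<close>; each factor contributes a prime or a unit.\<close>

lemma local_gen_in_products:
  assumes N: "primeideal N DD" and "invertible I"
  shows "\<exists>f. local_gen N I f \<and> f \<in> products_of (K\<lparr>carrier := loc N\<rparr>) (local_gens N)"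
  using assms(2)
proof (rule invertible_induct)
  have "local_gen N D \<one>" unfolding local_gen_def using D_loc[OF N] by auto
  moreover have "\<one> \<in> Units (K\<lparr>carrier := loc N\<rparr>)"
    using loc_Units_iff[OF N] D_loc[OF N] by simp
  ultimately show "\<exists>f. local_gen N D f \<and> f \<in> products_of (K\<lparr>carrier := loc N\<rparr>) (local_gens N)"
    by (intro exI[of _ \<one>] conjI products_of.unit)
next
  fix A I assume A: "A \<in> max_invertible" and I: "invertible I"
    and "\<exists>f. local_gen N I f \<and> f \<in> products_of (K\<lparr>carrier := loc N\<rparr>) (local_gens N)"
  then obtain g where g: "local_gen N I g" "g \<in> products_of (K\<lparr>carrier := loc N\<rparr>) (local_gens N)" by blast
  note iA = invertibleD[OF max_invertibleD(1)[OF A]]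
  obtain f where f: "local_gen N A f" using local_gen_exists[OF N max_invertibleD(1)[OF A]] by blast
  have "f \<in> products_of (K\<lparr>carrier := loc N\<rparr>) (local_gens N)"
  proof (cases "A \<subseteq> N")
    case True
    then have "f \<in> local_gens N" using f A unfolding local_gens_def by blast
    then show ?thesis by (rule products_of.gen)
  next
    case False
    then show ?thesis using local_gen_unit[OF N iA(1) False f] by (intro products_of.unit)
  qed
  then have "f \<otimes> g \<in> products_of (K\<lparr>carrier := loc N\<rparr>) (local_gens N)"
    using products_of.mult[OF _ g(2), of f] by simp
  moreover have "local_gen N (ideal_prod K A I) (f \<otimes> g)"
    by (rule local_gen_mult[OF N iA(4) invertibleD(4)[OF I] f g(1)])
  ultimately show "\<exists>f. local_gen N (ideal_prod K A I) f \<and>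
      f \<in> products_of (K\<lparr>carrier := loc N\<rparr>) (local_gens N)" by blast
qed

text \<open>After clearing a denominator \<open>s\<close>, which is a unit of \<open>loc N\<close>,
  the element \<open>s \<otimes> x\<close> is a local generator of its own principal ideal. It is
  therefore associated to the generator supplied by \<open>local_gen_in_products\<close>.\<close>

lemma loc_products:
  assumes N: "primeideal N DD" and x: "x \<in> loc N" "x \<noteq> \<zero>"
  shows "x \<in> products_of (K\<lparr>carrier := loc N\<rparr>) (local_gens N)"
proof -
  obtain s where s: "s \<in> D" "s \<notin> N" "s \<otimes> x \<in> D" "x \<in> carrier K" "s \<noteq> \<zero>" by (rule locE[OF N x(1)])
  let ?a = "s \<otimes> x"
  have a0: "?a \<noteq> \<zero>" using s x by (simp add: integral_iff)
  obtain f where f: "local_gen N ((\<lambda>d. d \<otimes> ?a) ` D) f"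
      "f \<in> products_of (K\<lparr>carrier := loc N\<rparr>) (local_gens N)"
    using local_gen_in_products[OF N principal_invertible[OF s(3) a0]] by blast
  have iff: "y \<in> (\<lambda>d. d \<otimes> ?a) ` D \<longleftrightarrow> y \<in> carrier K \<and> y \<otimes> inv ?a \<in> D" for y
    using principal_iff[of ?a y] s a0 by simp
  have "local_gen N ((\<lambda>d. d \<otimes> ?a) ` D) ?a"
    unfolding local_gen_def using principal_self[OF s(3)] a0 iff D_loc[OF N] by blast
  then obtain u where u: "u \<in> Units (K\<lparr>carrier := loc N\<rparr>)" "?a = u \<otimes> f"
    using local_gen_associated[OF N _ f(1)] s(3) by (metis D_closed(1,5) image_subsetI)
  have i: "inv s \<in> carrier K" "inv s \<otimes> s = \<one>" "inv s \<noteq> \<zero>" using field_inv[of s] s by auto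
  have "inv (inv s) = s" using comm_inv_char[of "inv s" s] i s by simp
  then have su: "inv s \<in> Units (K\<lparr>carrier := loc N\<rparr>)"
    unfolding loc_Units_iff[OF N] using inv_loc[OF N s(1,2)] D_loc[OF N s(1)] i by simp
  have "u \<otimes> f \<in> products_of (K\<lparr>carrier := loc N\<rparr>) (local_gens N)"
    using products_of.mult[OF products_of.unit[OF u(1)] f(2)] by simp
  then have "inv s \<otimes> ?a \<in> products_of (K\<lparr>carrier := loc N\<rparr>) (local_gens N)"
    using products_of.mult[OF products_of.unit[OF su], of "u \<otimes> f"] u(2) by simp
  moreover have "inv s \<otimes> ?a = x" using i s m_assoc[of "inv s" s x] by simp
  ultimately show ?thesis by simp
qed

lemma loc_factorial:
  assumes N: "primeideal N DD"
  shows "factorial_domain (K\<lparr>carrier := loc N\<rparr>)"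
proof (rule domain.factorial_domainI[OF loc_domain[OF N]])
  have "local_gens N \<subseteq> prime_elements (K\<lparr>carrier := loc N\<rparr>)" using local_gens_prime[OF N] by blast
  from products_of_mono[OF this]
  show "carrier (K\<lparr>carrier := loc N\<rparr>) - {\<zero>\<^bsub>K\<lparr>carrier := loc N\<rparr>\<^esub>}
    \<subseteq> products_of (K\<lparr>carrier := loc N\<rparr>) (prime_elements (K\<lparr>carrier := loc N\<rparr>))"
    using loc_products[OF N] by auto
qed

lemma locally_factorial: "locally_factorial K D"
  unfolding locally_factorial_def using loc_factorial maximalideal_primeideal by blast

text \<open>The only member of \<open>max_invertible\<close> inside \<open>A\<close> is
  \<open>A\<close> itself, so all primes in \<open>local_gens A\<close> are associated to a single
  \<open>p\<close>, and factorizations become a unit times a power of \<open>p\<close>.\<close>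

lemma loc_discrete_valuation_ring:
  assumes A: "A \<in> max_invertible"
  shows "discrete_valuation_ring (K\<lparr>carrier := loc A\<rparr>)"
proof -
  let ?V = "K\<lparr>carrier := loc A\<rparr>"
  have P: "primeideal A DD" by (rule max_invertible_prime[OF A])
  interpret V: domain ?V by (rule loc_domain[OF P])
  obtain p where p: "local_gen A A p" using local_gen_exists[OF P max_invertibleD(1)[OF A]] by blast
  then have "p \<in> local_gens A" using A unfolding local_gens_def by blast
  then have pp: "p \<in> loc A" "ring_prime\<^bsub>?V\<^esub> p" using local_gens_prime[OF P] by auto
  show ?thesis
  proof (rule V.discrete_valuation_ringI)
    show "p \<in> carrier ?V - {\<zero>\<^bsub>?V\<^esub>}" using pp by (auto simp: ring_prime_def)
    show "p \<notin> Units ?V" using pp by (auto simp: ring_prime_def prime_def)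
    fix x assume "x \<in> carrier ?V - {\<zero>\<^bsub>?V\<^esub>}"
    then have "x \<in> products_of ?V (local_gens A)" using loc_products[OF P] by simp
    then show "\<exists>u\<in>Units ?V. \<exists>k::nat. x = u \<otimes>\<^bsub>?V\<^esub> p [^]\<^bsub>?V\<^esub> k"
    proof induct
      case (unit u)
      then have "u = u \<otimes>\<^bsub>?V\<^esub> p [^]\<^bsub>?V\<^esub> (0::nat)" using V.Units_closed[OF unit] V.nat_pow_0 V.r_one by metis
      then show ?case using unit by blast
    next
      case (gen f)
      then obtain B where B: "B \<in> max_invertible" "B \<subseteq> A" "local_gen A B f"
        unfolding local_gens_def by blast
      then have "B = A" using max_invertible_eq[OF B(1) A] by blast
      then obtain u where u: "u \<in> Units ?V" "f = u \<otimes> p"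
        using local_gen_associated[OF P invertibleD(4)[OF max_invertibleD(1)[OF A]] p] B by blast
      then have "f = u \<otimes>\<^bsub>?V\<^esub> p [^]\<^bsub>?V\<^esub> (1::nat)" using V.nat_pow_eone[of p] pp(1) by simp
      then show ?case using u by blast
    next
      case (mult a b)
      then obtain u v and k l :: nat where uv: "u \<in> Units ?V" "a = u \<otimes>\<^bsub>?V\<^esub> p [^]\<^bsub>?V\<^esub> k"
        "v \<in> Units ?V" "b = v \<otimes>\<^bsub>?V\<^esub> p [^]\<^bsub>?V\<^esub> l" by blast
      have c: "u \<in> carrier ?V" "v \<in> carrier ?V" "p \<in> carrier ?V" using uv V.Units_closed pp by auto
      have "a \<otimes>\<^bsub>?V\<^esub> b = (u \<otimes>\<^bsub>?V\<^esub> v) \<otimes>\<^bsub>?V\<^esub> (p [^]\<^bsub>?V\<^esub> k \<otimes>\<^bsub>?V\<^esub> p [^]\<^bsub>?V\<^esub> l)"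
        unfolding uv(2,4) using c V.nat_pow_closed[OF c(3)] by (simp only: V.m_ac V.m_closed)
      then have "a \<otimes>\<^bsub>?V\<^esub> b = (u \<otimes>\<^bsub>?V\<^esub> v) \<otimes>\<^bsub>?V\<^esub> p [^]\<^bsub>?V\<^esub> (k + l)"
        using V.nat_pow_mult[OF c(3)] by metis
      then show ?case using uv V.Units_m_closed by blast
    qed
  qed
qed

lemma krull_domain: "krull_domain K D"
  unfolding krull_domain_def height_one_primes_eq
proof (intro conjI ballI)
  show "D = {x \<in> carrier K. \<forall>P\<in>max_invertible. x \<in> loc P}"
  proof (intro equalityI subsetI)
    fix x assume "x \<in> D"
    then show "x \<in> {x \<in> carrier K. \<forall>P\<in>max_invertible. x \<in> loc P}"
      using D_loc max_invertible_prime by auto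
  next
    fix x assume "x \<in> {x \<in> carrier K. \<forall>P\<in>max_invertible. x \<in> loc P}"
    then have x: "x \<in> carrier K" "\<And>P. P \<in> max_invertible \<Longrightarrow> x \<in> loc P" by auto
    have S: "{\<one>, x} \<subseteq> carrier K" using x by simp
    \<comment> \<open>\<open>Inv {\<one>, x}\<close> is the ideal of denominators of
      \<open>x\<close>. It lies in no member \<open>A\<close> of \<open>max_invertible\<close>,
      since \<open>x \<in> loc A\<close> supplies a denominator outside \<open>A\<close>; being a
      nonzero t-ideal, it is \<open>D\<close>.\<close>
    have iff: "z \<in> Inv {\<one>, x} \<longleftrightarrow> z \<in> D \<and> z \<otimes> x \<in> D" for z
      by (auto simp: Inv_iff)
    obtain a b where ab: "a \<in> D" "b \<in> D" "b \<noteq> \<zero>" "x = a \<otimes> inv b" using fraction[OF x(1)] by blast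
    then have "b \<otimes> x = a" using m_lcomm[of b a "inv b"] field_inv[of b] by simp
    then have "b \<in> Inv {\<one>, x}" using ab iff by simp
    then have t: "integral_t_ideal K D (Inv {\<one>, x})" using S iff ab(3) by (intro Inv_t_ideal) auto
    have "Inv {\<one>, x} = D"
    proof (rule ccontr)
      assume "Inv {\<one>, x} \<noteq> D"
      then obtain A where A: "A \<in> max_invertible" "Inv {\<one>, x} \<subseteq> A" using t_ideal_subset_max[OF t] by blast
      obtain s where "s \<in> D" "s \<notin> A" "s \<otimes> x \<in> D"
        by (rule locE[OF max_invertible_prime[OF A(1)] x(2)[OF A(1)]])
      then show False using iff A by blast
    qed
    then have "\<one> \<otimes> x \<in> D" using iff[of \<one>] by simp
    then show "x \<in> D" using x by simp
  qed
next
  fix P assume "P \<in> max_invertible"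
  then show "discrete_valuation_ring (K\<lparr>carrier := loc P\<rparr>)" by (rule loc_discrete_valuation_ring)
next
  fix x assume "x \<in> D - {\<zero>}"
  then have x: "x \<in> D" "x \<noteq> \<zero>" by auto
  have "{P \<in> max_invertible. x \<in> P} \<subseteq> {P \<in> max_invertible. (\<lambda>d. d \<otimes> x) ` D \<subseteq> P}"
    using principal_subset[OF primeD(2)[OF max_invertible_prime]] by blast
  then show "finite {P \<in> max_invertible. x \<in> P}"
    using finite_max_invertible[OF principal_invertible[OF x]] finite_subset by blast
qed

end

section \<open>Domination by principal ideals implies unique factorization\<close>

context fraction_field
begin

lemma principal_dominated_invertible:
  assumes "proper_nonzero_principal K D I"
  shows "proper_invertible K D I"
proof -
  obtain a where a: "a \<in> D" "I = (\<lambda>d. d \<otimes> a) ` D" "I \<noteq> {\<zero>}" "I \<noteq> D"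
    using assms principalideal_iff unfolding proper_nonzero_principal_def by blast
  have "a \<noteq> \<zero>"
  proof
    assume "a = \<zero>"
    then have "I = {\<zero>}" using a(2) D_closed(2) by (force simp: image_iff)
    then show False using a(3) by simp
  qed
  then show ?thesis using principal_invertible[OF a(1)] a unfolding proper_invertible_iff by simp
qed

text \<open>A proper principal ideal above a member of \<open>max_invertible\<close> is invertible,
  so by maximality the two coincide and its generator is prime. Factoring the principal ideal of
  \<open>x\<close> then factors \<open>x\<close> up to a unit.\<close>

lemma principal_dominated_factorial:
  assumes acc: "t_ACC_domain K D" and dom: "proper_t_ideals K D \<lhd>\<^sub>P proper_nonzero_principal K D"
  shows "factorial_domain DD"
proof -
  interpret X: invertibly_dominated K D
  proof unfold_locales
    show "proper_t_ideals K D \<lhd>\<^sub>P proper_invertible K D"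
      using dom principal_dominated_invertible unfolding dominated_by_def by blast
  qed (rule acc)
  interpret R: domain DD by (rule DD_domain)
  let ?Q = "products_of DD (prime_elements DD)"
  have gen: "\<exists>p\<in>D. ring_prime\<^bsub>DD\<^esub> p \<and> A = (\<lambda>d. d \<otimes> p) ` D" if A: "A \<in> X.max_invertible" for A
  proof -
    note A' = X.max_invertibleD[OF A]
    have "A \<in> proper_t_ideals K D"
      using A' invertible_t_ideal by (simp add: proper_t_ideals_iff)
    then obtain B where B: "A \<subseteq> B" "proper_nonzero_principal K D B"
      using dom unfolding dominated_by_def by blast
    then have "invertible B" "B \<noteq> D"
      using principal_dominated_invertible[of B] by (simp_all add: proper_invertible_iff)
    then have "B = A" using A'(3)[of B] B(1) by simp
    then have "principalideal A DD" using B(2) unfolding proper_nonzero_principal_def by simp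
    then obtain p where p: "p \<in> D" "A = (\<lambda>d. d \<otimes> p) ` D"
      unfolding principalideal_iff by blast
    have p0: "p \<noteq> \<zero>"
    proof
      assume "p = \<zero>"
      then have "A = {\<zero>}" using p(2) D_closed(2) by (force simp: image_iff)
      then show False using invertible_nonzero[OF A'(1)] by simp
    qed
    have "A = PIdl\<^bsub>DD\<^esub> p" using p by (auto simp: cgenideal_def)
    then have "ring_prime\<^bsub>DD\<^esub> p"
      using R.primeideal_iff_prime[of p] X.max_invertible_prime[OF A] p p0 by simp
    then show ?thesis using p by blast
  qed
  have inv: "\<exists>f\<in>?Q. f \<in> D \<and> I = (\<lambda>d. d \<otimes> f) ` D" if "invertible I" for I
    using that
  proof (rule X.invertible_induct)
    have "\<one> \<in> ?Q" using R.Units_one_closed products_of.unit[of \<one> DD] by simp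
    moreover have "D = (\<lambda>d. d \<otimes> \<one>) ` D" by (auto simp: image_iff)
    ultimately show "\<exists>f\<in>?Q. f \<in> D \<and> D = (\<lambda>d. d \<otimes> f) ` D" by blast
  next
    fix A I assume A: "A \<in> X.max_invertible" and "\<exists>f\<in>?Q. f \<in> D \<and> I = (\<lambda>d. d \<otimes> f) ` D"
    then obtain f where f: "f \<in> ?Q" "f \<in> D" "I = (\<lambda>d. d \<otimes> f) ` D" by blast
    obtain p where p: "p \<in> D" "ring_prime\<^bsub>DD\<^esub> p" "A = (\<lambda>d. d \<otimes> p) ` D" using gen[OF A] by blast
    have "p \<otimes> f \<in> ?Q" using products_of.mult[OF products_of.gen f(1), of p] p by simp
    moreover have "ideal_prod K A I = (\<lambda>d. d \<otimes> (p \<otimes> f)) ` D"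
    proof
      show "ideal_prod K A I \<subseteq> (\<lambda>d. d \<otimes> (p \<otimes> f)) ` D"
      proof (rule ideal_prod_subset)
        fix i j assume "i \<in> A" "j \<in> I"
        then obtain d e where de: "d \<in> D" "e \<in> D" "i = d \<otimes> p" "j = e \<otimes> f" using p f by blast
        then have "i \<otimes> j = (d \<otimes> e) \<otimes> (p \<otimes> f)" using p f by (simp add: m_ac)
        then show "i \<otimes> j \<in> (\<lambda>d. d \<otimes> (p \<otimes> f)) ` D" using de by blast
      next
        fix i j assume "i \<in> (\<lambda>d. d \<otimes> (p \<otimes> f)) ` D" "j \<in> (\<lambda>d. d \<otimes> (p \<otimes> f)) ` D"
        then obtain d e where de: "d \<in> D" "e \<in> D" "i = d \<otimes> (p \<otimes> f)" "j = e \<otimes> (p \<otimes> f)" by blast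
        then have "i \<oplus> j = (d \<oplus> e) \<otimes> (p \<otimes> f)" using p f by (simp add: l_distr)
        then show "i \<oplus> j \<in> (\<lambda>d. d \<otimes> (p \<otimes> f)) ` D" using de by blast
      qed
      show "(\<lambda>d. d \<otimes> (p \<otimes> f)) ` D \<subseteq> ideal_prod K A I"
      proof clarify
        fix d assume d: "d \<in> D"
        then have "(d \<otimes> p) \<otimes> f \<in> ideal_prod K A I"
          using p f principal_self[OF f(2)] by (intro ideal_prod.prod) auto
        then show "d \<otimes> (p \<otimes> f) \<in> ideal_prod K A I" using d p f by (simp add: m_assoc)
      qed
    qed
    ultimately show "\<exists>g\<in>?Q. g \<in> D \<and> ideal_prod K A I = (\<lambda>d. d \<otimes> g) ` D" using p f by blast
  qed
  \<comment> \<open>\<open>x\<close> and a product \<open>f\<close> of primes and units generate the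
    same ideal, so they differ by a unit \<open>c\<close> of \<open>D\<close>.\<close>
  have "x \<in> ?Q" if x: "x \<in> D" "x \<noteq> \<zero>" for x
  proof -
    obtain f where f: "f \<in> ?Q" "f \<in> D" "(\<lambda>d. d \<otimes> x) ` D = (\<lambda>d. d \<otimes> f) ` D"
      using inv[OF principal_invertible[OF x]] by blast
    have "x \<in> (\<lambda>d. d \<otimes> f) ` D" unfolding f(3)[symmetric] by (rule principal_self[OF x(1)])
    then obtain c where c: "c \<in> D" "x = c \<otimes> f" by blast
    have "f \<in> (\<lambda>d. d \<otimes> x) ` D" unfolding f(3) by (rule principal_self[OF f(2)])
    then obtain d where d: "d \<in> D" "f = d \<otimes> x" by blast
    have xK: "x \<in> carrier K" using x(1) by simp
    have "(c \<otimes> d) \<otimes> x = c \<otimes> (d \<otimes> x)" using c(1) d(1) xK by (simp add: m_assoc)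
    also have "\<dots> = \<one> \<otimes> x" unfolding d(2)[symmetric] c(2)[symmetric] using xK by simp
    finally have cd: "c \<otimes> d = \<one>" using m_rcancel[OF x(2) xK, of "c \<otimes> d" \<one>] c(1) d(1) by simp
    then have "d \<otimes> c = \<one>" using c(1) d(1) m_comm[of d c] by simp
    then have "c \<in> Units DD" using cd c(1) d(1) unfolding Units_def by auto
    from products_of.mult[OF products_of.unit[OF this] f(1)]
    show ?thesis unfolding c(2) by simp
  qed
  then show ?thesis by (intro R.factorial_domainI) auto
qed

end

theorem proposition5:
  fixes K :: "('a, 'b) ring_scheme" and D :: "'a set"
  assumes "quotient_field K D"
    and "\<not> field (K\<lparr>carrier := D\<rparr>)"
    and "t_ACC_domain K D"
  shows "(factorial_domain (K\<lparr>carrier := D\<rparr>) \<longleftrightarrow>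
            proper_t_ideals K D \<lhd>\<^sub>P proper_nonzero_principal K D)
       \<and> (locally_factorial K D \<and> krull_domain K D \<longleftrightarrow>
            proper_t_ideals K D \<lhd>\<^sub>P proper_invertible K D)"
proof -
  have K: "field K" "subring D K"
    "carrier K = {a \<otimes>\<^bsub>K\<^esub> inv\<^bsub>K\<^esub> b | a b. a \<in> D \<and> b \<in> D - {\<zero>\<^bsub>K\<^esub>}}"
    using assms(1) unfolding quotient_field_def by simp_all
  interpret fraction_field K D
  proof (intro fraction_field.intro[OF K(1)] fraction_field_axioms.intro)
    fix x assume "x \<in> carrier K"
    then show "\<exists>a\<in>D. \<exists>b\<in>D - {\<zero>\<^bsub>K\<^esub>}. x = a \<otimes>\<^bsub>K\<^esub> inv\<^bsub>K\<^esub> b"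
      by (subst (asm) K(3)) blast
  qed (rule K(2))
  show ?thesis
  proof (intro conjI iffI)
    show "proper_t_ideals K D \<lhd>\<^sub>P proper_nonzero_principal K D"
      if "factorial_domain (K\<lparr>carrier := D\<rparr>)"
      using that by (rule factorial_imp_dominated)
    show "factorial_domain (K\<lparr>carrier := D\<rparr>)"
      if "proper_t_ideals K D \<lhd>\<^sub>P proper_nonzero_principal K D"
      using assms(3) that by (rule principal_dominated_factorial)
    show "proper_t_ideals K D \<lhd>\<^sub>P proper_invertible K D"
      if "locally_factorial K D \<and> krull_domain K D"
      using that krull_imp_dominated by blast
  next
    assume "proper_t_ideals K D \<lhd>\<^sub>P proper_invertible K D"
    then interpret invertibly_dominated K D
      using assms(3) by unfold_locales
    show "locally_factorial K D" "krull_domain K D"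
      by (fact locally_factorial, fact krull_domain)
  qed
qed

end
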